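(* Let $\mathbb{K}$ be a field of characteristic $0$ and let $d\geq 4$. Let $M_1,\ldots,M_\tau$, $\tau=\binom{d+1}{2}$, be all the monomials of degree $d-1$ in the variables $u_1,u_2,u_3$, and let $f=\sum_{j=1}^{\tau}x_jM_j\in\mathbb{K}[x_1,\ldots,x_\tau,u_1,u_2,u_3]$ (the full Perazzo polynomial of type $3$ and degree $d$). Let $A=Q/\operatorname{Ann}_Q(f)$, where $Q=\mathbb{K}[X_1,\ldots,X_\tau,U_1,U_2,U_3]$ acts on $\mathbb{K}[x_1,\ldots,x_\tau,u_1,u_2,u_3]$ by $X_i=\partial/\partial x_i$, $U_i=\partial/\partial u_i$. Then the Hilbert function $H=(1,h_1,\ldots,h_{d-1},1)$ of $A$ (a standard graded Artinian Gorenstein algebra of socle degree $d$ and codimension $r=3+\binom{d+1}{2}$) is minimal: if $\hat H=(1,\hat h_1,\ldots,\hat h_{d-1},1)$ is the Hilbert function of a standard graded Artinian Gorenstein $\mathbb{K}$-algebra of socle degree $d$ and codimension $r$ with $\hat h_i\leq h_i$ for all $i$, then $\hat H=H$.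
   Context: A standard graded Artinian Gorenstein $\mathbb{K}$-algebra of socle degree $d$ has Hilbert function $(1,h_1,\ldots,h_d)$ with $h_d=1$ and $h_i=h_{d-i}$; its codimension is $h_1$ (ideals are assumed to contain no linear forms). *)

theory Defs
  imports Complex_Main "HOL-Library.Poly_Mapping"
begin

type_synonym 'a mpoly = "(nat \<Rightarrow>\<^sub>0 nat) \<Rightarrow>\<^sub>0 'a"

definition mdeg :: "(nat \<Rightarrow>\<^sub>0 nat) \<Rightarrow> nat" where
  "mdeg m = (\<Sum>k\<in>Poly_Mapping.keys m. Poly_Mapping.lookup m k)"

definition smult :: "'a::field \<Rightarrow> 'a mpoly \<Rightarrow> 'a mpoly" where
  "smult c p = Poly_Mapping.map (\<lambda>x. c * x) p"

definition Var :: "nat \<Rightarrow> 'a::field mpoly" where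
  "Var j = Poly_Mapping.single (Poly_Mapping.single j 1) 1"

definition Pol :: "nat \<Rightarrow> 'a::field mpoly set" where
  "Pol n = {p. \<forall>m\<in>Poly_Mapping.keys p. Poly_Mapping.keys m \<subseteq> {..<n}}"

definition Hom :: "nat \<Rightarrow> nat \<Rightarrow> 'a::field mpoly set" where
  "Hom n i = {p \<in> Pol n. \<forall>m\<in>Poly_Mapping.keys p. mdeg m = i}"

definition hcomp :: "nat \<Rightarrow> 'a::field mpoly \<Rightarrow> 'a mpoly" where
  "hcomp i p = Abs_poly_mapping (\<lambda>m. if mdeg m = i then Poly_Mapping.lookup p m else 0)"

definition vdim :: "'a::field mpoly set \<Rightarrow> nat" where
  "vdim S = vector_space.dim (smult :: 'a \<Rightarrow> 'a mpoly \<Rightarrow> 'a mpoly) S"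

definition hom_ideal :: "nat \<Rightarrow> 'a::field mpoly set \<Rightarrow> bool" where
  "hom_ideal n I \<longleftrightarrow> I \<subseteq> Pol n \<and> 0 \<in> I \<and>
     (\<forall>p\<in>I. \<forall>q\<in>I. p + q \<in> I) \<and> (\<forall>p\<in>I. \<forall>q\<in>Pol n. q * p \<in> I) \<and>
     (\<forall>p\<in>I. \<forall>i. hcomp i p \<in> I)"

text \<open>Hilbert function of the standard graded algebra Pol n / I:
  h_i = dim (R_i / I_i) = dim R_i - dim I_i\<close>
definition hilb :: "nat \<Rightarrow> 'a::field mpoly set \<Rightarrow> nat \<Rightarrow> nat" where
  "hilb n I i = vdim (Hom n i :: 'a mpoly set) - vdim (I \<inter> Hom n i)"

text \<open>preimage in Pol n of the socle (0 :_A m) of A = Pol n / I\<close>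
definition soc :: "nat \<Rightarrow> 'a::field mpoly set \<Rightarrow> 'a mpoly set" where
  "soc n I = {p \<in> Pol n. \<forall>j<n. Var j * p \<in> I}"

text \<open>Pol n / I is a standard graded Artinian Gorenstein algebra of socle degree d:
  I homogeneous, A_i = 0 for i > d, A_d \<noteq> 0, and the (graded) socle of A
  is one-dimensional.\<close>
definition AG :: "nat \<Rightarrow> 'a::field mpoly set \<Rightarrow> nat \<Rightarrow> bool" where
  "AG n I d \<longleftrightarrow> hom_ideal n I \<and> (\<forall>i>d. Hom n i \<subseteq> I) \<and> \<not> Hom n d \<subseteq> I \<and>
     (\<Sum>i\<le>d. vdim (soc n I \<inter> Hom n i) - vdim (I \<inter> Hom n i)) = 1"

definition pderiv :: "nat \<Rightarrow> 'a::field mpoly \<Rightarrow> 'a mpoly" where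
  "pderiv k p = Abs_poly_mapping
     (\<lambda>m. of_nat (Poly_Mapping.lookup m k + 1) * Poly_Mapping.lookup p (m + Poly_Mapping.single k 1))"

definition dmono :: "(nat \<Rightarrow>\<^sub>0 nat) \<Rightarrow> 'a::field mpoly \<Rightarrow> 'a mpoly" where
  "dmono \<alpha> = foldr (\<lambda>k g. (pderiv k ^^ Poly_Mapping.lookup \<alpha> k) \<circ> g)
                  (sorted_list_of_set (Poly_Mapping.keys \<alpha>)) id"

definition act :: "'a::field mpoly \<Rightarrow> 'a mpoly \<Rightarrow> 'a mpoly" where
  "act q F = (\<Sum>\<alpha>\<in>Poly_Mapping.keys q. smult (Poly_Mapping.lookup q \<alpha>) (dmono \<alpha> F))"

definition Ann :: "nat \<Rightarrow> 'a::field mpoly \<Rightarrow> 'a mpoly set" where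
  "Ann n F = {q \<in> Pol n. act q F = 0}"

end

theory Submission
  imports Defs
begin

text \<open>
  Let \<open>A\<close> be a Gorenstein quotient with socle degree \<open>d\<close> and let \<open>l\<close> be a generic linear form. Then
  \<open>B = A/(0 : l)\<close> is Gorenstein of socle degree \<open>d - 1\<close>, and \<open>h\<^sub>i\<^sub>+\<^sub>1(A) = h\<^sub>i(B) + dim (A/l)\<^sub>i\<^sub>+\<^sub>1\<close>.
  Special cases of Green's hyperplane restriction theorem bound \<open>dim (A/l)\<^sub>d\<^sub>-\<^sub>1\<close> from above, and the
  symmetry of the Hilbert functions of \<open>A\<close> and \<open>B\<close> carries this over to degree 2. Macaulay's bound
  (a Hilbert function with value at most \<open>i\<close> in degree \<open>i\<close> no longer grows) then forces
  \<open>dim (A/l)\<^sub>i \<ge> i + 1\<close> for \<open>2 \<le> i < d\<close>, so that \<open>B\<close> satisfies the hypotheses for \<open>d - 1\<close> and induction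
  on \<open>d\<close> applies; only \<open>d = 4\<close> needs a separate numerical argument.

  Generic linear forms are taken on the moment curve \<open>t \<mapsto> \<Sum>j. t\<^sup>j x\<^sub>j\<close>, and ``generic'' means for all but
  finitely many \<open>t\<close>. Since any \<open>n\<close> points of the curve span the linear forms, this avoids semicontinuity
  of rank.
\<close>

section \<open>Dimensions of finitely spanned subspaces\<close>

text \<open>The induction proves a sharper claim: the upper bound \<open>perazzo_hilb d\<close>
  together with the exact value in degree 1 forces equality in all degrees i with 1 <= i < d. It can
  start at d = 3, where symmetry alone settles the claim. The recurrence
  \<open>perazzo_hilb d (i + 1)\<close> = \<open>perazzo_hilb (d - 1) i\<close> + (i + 2) ties it to
  the bounds on A/l: dim (A/l) >= i + 2 in degree i + 1 is exactly what hands the upper bound down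
  to B, and it returns the lower bound for A afterwards. Why d = 4 is special: by symmetry A has
  dimension C(d+1,2) + 3 in degree d - 1, while the restriction bound dim (A/l) <= d in that degree
  holds up to C(d+1,2) + d - 2. The surplus 3 fits only for d >= 5; for d = 4 it is one too large
  and the bound becomes 5 instead of 4. For the Perazzo polynomial itself only an upper bound on the
  Hilbert function is computed in degrees between 1 and d. Its exact value falls out at the end,
  since it is squeezed between that bound and the competitor.\<close>

context vector_space
begin

text \<open>The polynomial ring is infinite-dimensional, and \<open>dim\<close> is informative only
  on finitely spanned subspaces; \<open>F\<close> records such a spanning set here and
  below.\<close>

lemma finite_basis_extend:
  assumes "subspace T" "T \<subseteq> span F" "finite F" "independent A" "A \<subseteq> T"
  obtains B where "A \<subseteq> B" "B \<subseteq> T" "independent B" "finite B" "span B = T" "card B = dim T"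
proof -
  obtain B where B: "A \<subseteq> B" "B \<subseteq> T" "independent B" "T \<subseteq> span B"
    using maximal_independent_subset_extend[OF assms(5,4)] by blast
  have "finite B"
    using independent_span_bound[OF assms(3) B(3)] B(2) assms(2) by auto
  moreover have "span B = T"
    using B assms(1) span_subspace by blast
  ultimately show ?thesis
    using B that basis_card_eq_dim by blast
qed

lemma finite_basis_exists:
  assumes "subspace T" "T \<subseteq> span F" "finite F"
  obtains B where "B \<subseteq> T" "independent B" "finite B" "span B = T" "card B = dim T"
  by (rule finite_basis_extend[OF assms independent_empty empty_subsetI]) (rule that)

lemma dim_subspace_mono:
  assumes "subspace S" "subspace T" "S \<subseteq> T" "T \<subseteq> span F" "finite F"
  shows "dim S \<le> dim T"
proof -
  obtain B where B: "B \<subseteq> S" "independent B" "finite B" "span B = S" "card B = dim S"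
    by (rule finite_basis_exists[OF assms(1) order_trans[OF assms(3,4)] assms(5)])
  obtain C where C: "B \<subseteq> C" "C \<subseteq> T" "independent C" "finite C" "span C = T" "card C = dim T"
    by (rule finite_basis_extend[OF assms(2,4,5) B(2) order_trans[OF B(1) assms(3)]])
  show ?thesis
    using B C by (metis card_mono)
qed

lemma subspace_eq_of_dim_le:
  assumes "subspace S" "subspace T" "S \<subseteq> T" "T \<subseteq> span F" "finite F" "dim T \<le> dim S"
  shows "S = T"
proof -
  obtain B where B: "B \<subseteq> S" "independent B" "finite B" "span B = S" "card B = dim S"
    by (rule finite_basis_exists[OF assms(1) order_trans[OF assms(3,4)] assms(5)])
  obtain C where C: "B \<subseteq> C" "C \<subseteq> T" "independent C" "finite C" "span C = T" "card C = dim T"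
    by (rule finite_basis_extend[OF assms(2,4,5) B(2) order_trans[OF B(1) assms(3)]])
  have "B = C"
    using B C assms(6) by (metis card_seteq)
  then show ?thesis using B C by blast
qed

text \<open>Rank-nullity for the map from R to the quotient by V induced by f, phrased without
  quotient spaces.\<close>

lemma dim_span_Un_image:
  assumes f: "module_hom scale scale f"
    and R: "subspace R" "R \<subseteq> span F" "finite F"
    and V: "subspace V" "V \<subseteq> span G" "finite G"
  shows "dim (span (V \<union> f ` R)) + dim {g \<in> R. f g \<in> V} = dim V + dim R"
proof -
  interpret f: module_hom scale scale f by fact
  let ?P = "{g \<in> R. f g \<in> V}"
  have P: "subspace ?P"
    using subspace_inter[OF R(1) f.subspace_linear_preimage[OF V(1)]]
    unfolding Int_def mem_Collect_eq .
  obtain A where A: "A \<subseteq> ?P" "independent A" "finite A" "span A = ?P" "card A = dim ?P"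
    by (rule finite_basis_exists[OF P _ R(3)]) (use R in auto)
  have AR: "A \<subseteq> R" using A by blast
  obtain B where B: "A \<subseteq> B" "B \<subseteq> R" "independent B" "finite B" "span B = R" "card B = dim R"
    by (rule finite_basis_extend[OF R A(2) AR])
  obtain D where D: "D \<subseteq> V" "independent D" "finite D" "span D = V" "card D = dim V"
    by (rule finite_basis_exists[OF V])
  \<comment> \<open>The images of B - A are independent modulo V: a relation for f c would put some
    c - y into the preimage, which A spans, and make B dependent.\<close>
  have step: "independent (D \<union> f ` C) \<and> card (D \<union> f ` C) = card D + card C"
    if "finite C" "C \<subseteq> B - A" for C
    using that
  proof (induction C rule: finite_induct)
    case empty
    then show ?case using D by simp
  next
    case (insert c C)
    have "f c \<notin> span (D \<union> f ` C)"
    proof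
      assume "f c \<in> span (D \<union> f ` C)"
      then obtain v y where vy: "f c = v + f y" "v \<in> V" "y \<in> span C"
        unfolding span_Un f.span_image D(4) by blast
      have "y \<in> R" using vy(3) insert.prems B(2) R(1) span_minimal[of C R] by blast
      moreover have "c \<in> R" using insert.prems B by blast
      moreover have "f (c - y) = v" using vy(1) f.diff by simp
      ultimately have "c - y \<in> ?P"
        using vy(2) subspace_diff[OF R(1)] by simp
      then have "c - y \<in> span A" using A by blast
      then have "c - y + y \<in> span (A \<union> C)"
        using vy(3) unfolding span_Un by blast
      moreover have "A \<union> C \<subseteq> B - {c}" using insert.hyps insert.prems B(1) by auto
      ultimately have "c \<in> span (B - {c})" using span_mono[of "A \<union> C" "B - {c}"] by auto
      then show False using B(3) insert.prems unfolding dependent_def by blast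
    qed
    moreover from this have "f c \<notin> D \<union> f ` C" by (meson span_base)
    moreover have "independent (D \<union> f ` C)" "card (D \<union> f ` C) = card D + card C"
      using insert by auto
    moreover have "D \<union> f ` insert c C = insert (f c) (D \<union> f ` C)" by blast
    moreover have "finite (D \<union> f ` C)" using insert.hyps D(3) by simp
    ultimately show ?case
      using insert.hyps by (simp add: independent_insertI del: Un_iff)
  qed
  have *: "independent (D \<union> f ` (B - A))" "card (D \<union> f ` (B - A)) = card D + card (B - A)"
    using step[of "B - A"] B(4) by auto
  have "span (V \<union> f ` R) = span (D \<union> f ` (B - A))"
  proof (rule span_unique)
    show "V \<union> f ` R \<subseteq> span (D \<union> f ` (B - A))"
    proof -
      have "V \<subseteq> span (D \<union> f ` (B - A))" using D(4) span_mono by blast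
      moreover have "f b \<in> span (D \<union> f ` (B - A))" if "b \<in> B" for b
      proof (cases "b \<in> A")
        case True
        then have "f b \<in> V" using A by blast
        then show ?thesis using calculation by blast
      next
        case False
        then show ?thesis using that by (auto intro: span_base)
      qed
      then have "f ` B \<subseteq> span (D \<union> f ` (B - A))" by blast
      then have "span (f ` B) \<subseteq> span (D \<union> f ` (B - A))" by (simp add: span_minimal)
      ultimately show ?thesis unfolding f.span_image B(5) by blast
    qed
    fix T' assume T': "V \<union> f ` R \<subseteq> T'" "subspace T'"
    have "f ` (B - A) \<subseteq> f ` R" using B(2) by auto
    then have "D \<union> f ` (B - A) \<subseteq> T'" using D(1) T'(1) by (metis Un_least Un_subset_iff order_trans)
    then show "span (D \<union> f ` (B - A)) \<subseteq> T'" using T'(2) by (rule span_minimal)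
  qed auto
  then have "dim (span (V \<union> f ` R)) = card D + card (B - A)"
    using * by (metis dim_span_eq_card_independent)
  moreover have "card (B - A) + card A = card B"
    using B(1,4) by (metis card_Diff_subset card_mono finite_subset le_add_diff_inverse2)
  ultimately show ?thesis using A D B by linarith
qed

end

section \<open>Graded pieces of the polynomial ring\<close>

lemma smult_eq_mult: "smult c p = Poly_Mapping.single 0 c * p"
  unfolding smult_def by (rule mult_map_scale_conv_mult)

lemma lookup_smult [simp]: "Poly_Mapping.lookup (smult c p) m = c * Poly_Mapping.lookup p m"
  unfolding smult_def by (simp add: map.rep_eq when_def)

global_interpretation mp: vector_space "smult :: 'a::field \<Rightarrow> 'a mpoly \<Rightarrow> 'a mpoly"
  by standard (auto intro!: poly_mapping_eqI simp: lookup_add algebra_simps)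

lemma vdim_eq_dim: "vdim = mp.dim"
  by (simp add: vdim_def fun_eq_iff)

lemma mult_smult_right: "p * smult c q = smult c (p * q)"
  by (simp add: smult_eq_mult ac_simps)

lemma mult_smult_left: "smult c p * q = smult c (p * q)"
  by (simp add: smult_eq_mult ac_simps)

lemma module_hom_times: "module_hom smult smult ((*) p)"
  unfolding module_hom_iff
  by (simp add: mp.module_axioms distrib_left mult_smult_right)

lemma sum_single_lookup:
  assumes "finite S" "Poly_Mapping.keys p \<subseteq> S"
  shows "(\<Sum>m\<in>S. Poly_Mapping.single m (Poly_Mapping.lookup p m)) = p"
  using assms
  by (intro poly_mapping_eqI) (auto simp: lookup_sum lookup_single when_def in_keys_iff)

lemma mdeg_eq_sum:
  assumes "finite S" "Poly_Mapping.keys m \<subseteq> S"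
  shows "mdeg m = (\<Sum>k\<in>S. Poly_Mapping.lookup m k)"
  unfolding mdeg_def using assms
  by (intro sum.mono_neutral_left) (auto simp: in_keys_iff)

lemma mdeg_add: "mdeg (a + b) = mdeg a + mdeg b"
proof -
  let ?S = "Poly_Mapping.keys a \<union> Poly_Mapping.keys b"
  have "Poly_Mapping.keys (a + b) \<subseteq> ?S" by (rule keys_add)
  then show ?thesis
    by (simp add: mdeg_eq_sum[of ?S] lookup_add sum.distrib)
qed

lemma mdeg_zero [simp]: "mdeg 0 = 0"
  by (simp add: mdeg_def)

lemma mdeg_single [simp]: "mdeg (Poly_Mapping.single k c) = c"
  by (simp add: mdeg_def)

lemma mdeg_eq_0_iff: "mdeg m = 0 \<longleftrightarrow> m = 0"
  by (auto simp: mdeg_def in_keys_iff intro!: poly_mapping_eqI)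

lemma keys_add_nat:
  "Poly_Mapping.keys (a + b) = Poly_Mapping.keys a \<union> Poly_Mapping.keys (b :: 'b \<Rightarrow>\<^sub>0 nat)"
  by (auto simp: in_keys_iff lookup_add)

lemma single_add_diff:
  assumes "k \<in> Poly_Mapping.keys (m :: 'b \<Rightarrow>\<^sub>0 nat)"
  shows "Poly_Mapping.single k 1 + (m - Poly_Mapping.single k 1) = m"
  using assms
  by (intro poly_mapping_eqI)
    (auto simp: lookup_add lookup_minus lookup_single when_def in_keys_iff)

lemma finite_monomials:
  assumes "finite S"
  shows "finite {m. Poly_Mapping.keys m \<subseteq> S \<and> mdeg m = i}"
proof (induction i)
  case 0
  show ?case by (simp add: mdeg_eq_0_iff)
next
  case (Suc i)
  have "{m. Poly_Mapping.keys m \<subseteq> S \<and> mdeg m = Suc i}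
      \<subseteq> (\<lambda>(k, m). Poly_Mapping.single k 1 + m) ` (S \<times> {m. Poly_Mapping.keys m \<subseteq> S \<and> mdeg m = i})"
  proof
    fix m assume m: "m \<in> {m. Poly_Mapping.keys m \<subseteq> S \<and> mdeg m = Suc i}"
    then have "m \<noteq> 0" by auto
    then obtain k where k: "k \<in> Poly_Mapping.keys m" by (metis all_not_in_conv keys_eq_empty)
    have eq: "m = Poly_Mapping.single k 1 + (m - Poly_Mapping.single k 1)"
      using single_add_diff[OF k] by simp
    have "mdeg m = 1 + mdeg (m - Poly_Mapping.single k 1)"
      by (subst eq) (simp add: mdeg_add)
    moreover have "Poly_Mapping.keys (m - Poly_Mapping.single k 1) \<subseteq> Poly_Mapping.keys m"
      by (subst (2) eq) (simp only: keys_add_nat Un_upper2)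
    ultimately show "m \<in> (\<lambda>(k, m). Poly_Mapping.single k 1 + m) `
        (S \<times> {m. Poly_Mapping.keys m \<subseteq> S \<and> mdeg m = i})"
      using m k eq by (intro image_eqI[of _ _ "(k, m - Poly_Mapping.single k 1)"]) auto
  qed
  then show ?case
    using finite_subset Suc assms by (metis (no_types, lifting) finite_SigmaI finite_imageI)
qed

lemma subspace_Hom: "mp.subspace (Hom n i)"
proof (rule mp.subspaceI)
  fix p q :: "'a mpoly" and c
  assume p: "p \<in> Hom n i"
  have "Poly_Mapping.keys (smult c p) \<subseteq> Poly_Mapping.keys p" by (auto simp: in_keys_iff)
  with p show "smult c p \<in> Hom n i" unfolding Hom_def Pol_def by blast
  assume "q \<in> Hom n i"
  with p show "p + q \<in> Hom n i"
    using keys_add[of p q] unfolding Hom_def Pol_def by blast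
qed (simp add: Hom_def Pol_def)

lemmas Hom_closed [simp] = mp.subspace_0[OF subspace_Hom] mp.subspace_add[OF subspace_Hom]
  mp.subspace_scale[OF subspace_Hom] mp.subspace_diff[OF subspace_Hom]

lemma Hom_mult:
  assumes "p \<in> Hom n i" "q \<in> Hom n j"
  shows "p * q \<in> Hom n (i + j)"
  unfolding Hom_def Pol_def
proof (safe)
  fix m k assume m: "m \<in> Poly_Mapping.keys (p * q)" 
  then obtain a b where ab: "m = a + b" "a \<in> Poly_Mapping.keys p" "b \<in> Poly_Mapping.keys q"
    using keys_mult[of p q] by blast
  show "mdeg m = i + j" using ab assms by (auto simp: Hom_def mdeg_add)
  show "k < n" if "k \<in> Poly_Mapping.keys m"
    using that ab assms by (fastforce simp: Hom_def Pol_def keys_add_nat)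
qed

lemma Hom_mult':
  "p \<in> Hom n i \<Longrightarrow> q \<in> Hom n j \<Longrightarrow> k = i + j \<Longrightarrow> p * q \<in> Hom n k"
  by (simp add: Hom_mult)

lemma single_in_Hom:
  "Poly_Mapping.keys m \<subseteq> {..<n} \<Longrightarrow> mdeg m = i \<Longrightarrow> Poly_Mapping.single m c \<in> Hom n i"
  by (auto simp: Hom_def Pol_def)

lemma Var_in_Hom: "j < n \<Longrightarrow> Var j \<in> Hom n 1"
  unfolding Var_def by (rule single_in_Hom) auto

lemma Hom_subset_span:
  "Hom n i \<subseteq> mp.span ((\<lambda>m. Poly_Mapping.single m 1) ` {m. Poly_Mapping.keys m \<subseteq> {..<n} \<and> mdeg m = i})"
    (is "_ \<subseteq> mp.span (_ ` ?M)")
proof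
  fix p :: "'a mpoly" assume p: "p \<in> Hom n i"
  then have "Poly_Mapping.keys p \<subseteq> ?M" by (auto simp: Hom_def Pol_def)
  then have "p = (\<Sum>m\<in>?M. Poly_Mapping.single m (Poly_Mapping.lookup p m))"
    using sum_single_lookup[of ?M p] finite_monomials[of "{..<n}" i] by simp
  also have "\<dots> = (\<Sum>m\<in>?M. smult (Poly_Mapping.lookup p m) (Poly_Mapping.single m 1))"
    by (simp add: smult_eq_mult mult_single)
  also have "\<dots> \<in> mp.span ((\<lambda>m. Poly_Mapping.single m 1) ` ?M)"
    by (intro mp.span_sum mp.span_scale mp.span_base) auto
  finally show "p \<in> mp.span ((\<lambda>m. Poly_Mapping.single m 1) ` ?M)" .
qed

lemma Hom_finite_span: obtains F where "finite F" "Hom n i \<subseteq> mp.span F"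
  by (rule that[OF _ Hom_subset_span]) (simp add: finite_monomials)

text \<open>Generation in degree 1 enters here: every monomial of positive degree is divisible by a
  variable.\<close>

lemma Hom_Suc_subset_subspace:
  assumes W: "mp.subspace W" and V: "\<And>j g. j < n \<Longrightarrow> g \<in> Hom n i \<Longrightarrow> Var j * g \<in> W"
  shows "Hom n (Suc i) \<subseteq> W"
proof -
  have "Poly_Mapping.single m 1 \<in> W" if m: "Poly_Mapping.keys m \<subseteq> {..<n}" "mdeg m = Suc i" for m
  proof -
    have "m \<noteq> 0" using m by auto
    then obtain k where k: "k \<in> Poly_Mapping.keys m" by (metis all_not_in_conv keys_eq_empty)
    define m' where "m' = m - Poly_Mapping.single k 1"
    have eq: "m = Poly_Mapping.single k 1 + m'"
      using single_add_diff[OF k] by (simp add: m'_def)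
    have "Poly_Mapping.single m' 1 \<in> Hom n i"
      using m unfolding eq by (intro single_in_Hom) (auto simp: keys_add_nat mdeg_add)
    then have "Var k * Poly_Mapping.single m' 1 \<in> W"
      using V k m by auto
    then show ?thesis unfolding Var_def mult_single eq by simp
  qed
  then have "mp.span ((\<lambda>m. Poly_Mapping.single m 1) `
      {m. Poly_Mapping.keys m \<subseteq> {..<n} \<and> mdeg m = Suc i}) \<subseteq> W"
    by (intro mp.span_minimal W) auto
  then show ?thesis
    using Hom_subset_span by (rule order_trans[rotated])
qed

text \<open>Dimension of a graded piece of the quotient. The truncated subtraction is exact on
  graded subspaces by \<open>graded_subspace_dim_le\<close>.\<close>

definition cod :: "nat \<Rightarrow> nat \<Rightarrow> 'a::field mpoly set \<Rightarrow> nat" where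
  "cod n i V = mp.dim (Hom n i :: 'a mpoly set) - mp.dim V"

definition graded_subspace :: "nat \<Rightarrow> nat \<Rightarrow> 'a::field mpoly set \<Rightarrow> bool" where
  "graded_subspace n i V \<longleftrightarrow> mp.subspace V \<and> V \<subseteq> Hom n i"

lemma graded_subspace_dim_le:
  fixes V :: "'a::field mpoly set"
  assumes "graded_subspace n i V" shows "mp.dim V \<le> mp.dim (Hom n i :: 'a mpoly set)"
proof -
  obtain F where "finite F" "(Hom n i :: 'a mpoly set) \<subseteq> mp.span F" by (rule Hom_finite_span)
  then show ?thesis
    using mp.dim_subspace_mono[OF _ subspace_Hom, of V] assms unfolding graded_subspace_def by metis
qed

lemma graded_subspace_dim_mono:
  assumes "graded_subspace n i V" "graded_subspace n i W" "V \<subseteq> W" shows "mp.dim V \<le> mp.dim W"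
proof -
  obtain F where "finite F" "(Hom n i :: 'a mpoly set) \<subseteq> mp.span F" by (rule Hom_finite_span)
  then show ?thesis
    using mp.dim_subspace_mono[of V W F] assms unfolding graded_subspace_def by (metis order_trans)
qed

lemma cod_mono:
  assumes "graded_subspace n i V" "graded_subspace n i W" "V \<subseteq> W" shows "cod n i W \<le> cod n i V"
  using graded_subspace_dim_mono[OF assms] by (simp add: cod_def)

lemma graded_subspace_eq_of_dim_le:
  assumes "graded_subspace n i V" "graded_subspace n i W" "V \<subseteq> W" "mp.dim W \<le> mp.dim V" shows "V = W"
proof -
  obtain F where "finite F" "(Hom n i :: 'a mpoly set) \<subseteq> mp.span F" by (rule Hom_finite_span)
  then show ?thesis
    using mp.subspace_eq_of_dim_le[of V W F] assms unfolding graded_subspace_def by (metis order_trans)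
qed

lemma graded_subspace_Hom: "graded_subspace n i (Hom n i)"
  by (simp add: graded_subspace_def subspace_Hom)

lemma cod_eq_0_iff:
  assumes "graded_subspace n i V" shows "cod n i V = 0 \<longleftrightarrow> V = Hom n i"
  using graded_subspace_eq_of_dim_le[OF assms graded_subspace_Hom] graded_subspace_dim_le[OF assms] assms
  by (auto simp: cod_def graded_subspace_def)

definition colon :: "nat \<Rightarrow> nat \<Rightarrow> 'a::field mpoly \<Rightarrow> 'a mpoly set \<Rightarrow> 'a mpoly set" where
  "colon n i l V = {g \<in> Hom n i. l * g \<in> V}"

text \<open>The index i is the degree of the multipliers; V and the result live in degree i +
  1.\<close>

definition add_multiples :: "nat \<Rightarrow> nat \<Rightarrow> 'a::field mpoly \<Rightarrow> 'a mpoly set \<Rightarrow> 'a mpoly set" where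
  "add_multiples n i l V = mp.span (V \<union> (*) l ` Hom n i)"

lemma subspace_preimage_times:
  assumes "mp.subspace R" "mp.subspace V"
  shows "mp.subspace {g \<in> R. l * g \<in> V}"
proof -
  interpret f: module_hom smult smult "(*) l" by (rule module_hom_times)
  show ?thesis
    using mp.subspace_inter[OF assms(1) f.subspace_linear_preimage[OF assms(2)]]
    unfolding Int_def mem_Collect_eq .
qed

lemma graded_subspace_colon:
  assumes "mp.subspace V" shows "graded_subspace n i (colon n i l V)"
  unfolding graded_subspace_def colon_def using subspace_preimage_times[OF subspace_Hom assms] by auto

lemma graded_subspace_add_multiples:
  assumes "graded_subspace n (Suc i) V" "l \<in> Hom n 1" shows "graded_subspace n (Suc i) (add_multiples n i l V)"
proof -
  have "l * g \<in> Hom n (Suc i)" if "g \<in> Hom n i" for g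
    using Hom_mult'[OF assms(2) that] by simp
  then have "V \<union> (*) l ` Hom n i \<subseteq> Hom n (Suc i)" using assms(1) by (auto simp: graded_subspace_def)
  then show ?thesis
    unfolding graded_subspace_def add_multiples_def by (simp add: mp.span_minimal subspace_Hom)
qed

lemma add_multiples_upper: "V \<subseteq> add_multiples n i l V" "g \<in> Hom n i \<Longrightarrow> l * g \<in> add_multiples n i l V"
  unfolding add_multiples_def by (auto intro: mp.span_base)

lemma add_multiples_least:
  assumes "mp.subspace W" "V \<subseteq> W" "\<And>g. g \<in> Hom n i \<Longrightarrow> l * g \<in> W" shows "add_multiples n i l V \<subseteq> W"
  unfolding add_multiples_def using assms by (intro mp.span_minimal) auto

lemma subspace_add_multiples: "mp.subspace (add_multiples n i l V)"
  unfolding add_multiples_def by simp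

lemma dim_preimage_times:
  assumes V: "graded_subspace n j V" and R: "graded_subspace n i R"
  shows "mp.dim (mp.span (V \<union> (*) l ` R)) + mp.dim {g \<in> R. l * g \<in> V} = mp.dim V + mp.dim R"
proof -
  obtain F where F: "finite F" "(Hom n i :: 'a mpoly set) \<subseteq> mp.span F" by (rule Hom_finite_span)
  obtain G where G: "finite G" "(Hom n j :: 'a mpoly set) \<subseteq> mp.span G" by (rule Hom_finite_span)
  show ?thesis
    using mp.dim_span_Un_image[OF module_hom_times, of R F V G l] F G V R
    unfolding graded_subspace_def by (metis order_trans)
qed

text \<open>Dimension count for the exact sequence in which multiplication by l embeds R/(V : l)
  into R/V with cokernel R/(V + lR).\<close>

lemma cod_colon_add_multiples:
  assumes "graded_subspace n (Suc i) V" "l \<in> Hom n 1"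
  shows "cod n (Suc i) V = cod n i (colon n i l V) + cod n (Suc i) (add_multiples n i l V)"
proof -
  note d = dim_preimage_times[OF assms(1) graded_subspace_Hom[of n i], of l]
  have "graded_subspace n i (colon n i l V)" using assms(1) graded_subspace_colon graded_subspace_def by blast
  note this[THEN graded_subspace_dim_le] graded_subspace_dim_le[OF assms(1)] graded_subspace_dim_le[OF graded_subspace_add_multiples[OF assms]]
  then show ?thesis using d unfolding cod_def colon_def add_multiples_def by linarith
qed

section \<open>Generic hyperplane restriction\<close>

text \<open>A Vandermonde argument without determinants: a polynomial with vector coefficients and m
  values in W is divided by t - s, and the quotient has one coefficient and one point fewer.\<close>

lemma (in vector_space) coefficients_in_subspace:
  assumes W: "subspace W"
  shows "finite T \<Longrightarrow> m \<le> card T \<Longrightarrow> (\<And>t. t \<in> T \<Longrightarrow> (\<Sum>j<m. scale (t ^ j) (w j)) \<in> W) \<Longrightarrow> k < m \<Longrightarrow> w k \<in> W"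
proof (induction m arbitrary: T w k)
  case 0
  then show ?case by simp
next
  case (Suc m)
  then obtain s where s: "s \<in> T" by (metis card.empty equals0I le_zero_eq nat.distinct(1))
  \<comment> \<open>\<open>v\<close> lists the coefficients of the quotient of \<open>\<Sum>j\<le>m. t ^ j w j\<close> by \<open>t - s\<close>\<close>
  define v where "v k = (\<Sum>j\<in>{Suc k..m}. scale (s ^ (j - Suc k)) (w j))" for k
  have v_top: "v m = 0" by (simp add: v_def)
  have v_rec: "v k = w (Suc k) + scale s (v (Suc k))" if "k < m" for k
  proof -
    have "v k = w (Suc k) + (\<Sum>j\<in>{Suc (Suc k)..m}. scale (s ^ (j - Suc k)) (w j))"
      unfolding v_def using that by (subst sum.atLeast_Suc_atMost) auto
    also have "(\<Sum>j\<in>{Suc (Suc k)..m}. scale (s ^ (j - Suc k)) (w j)) = scale s (v (Suc k))"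
      unfolding v_def scale_sum_right scale_scale
      by (intro sum.cong refl arg_cong2[of _ _ _ _ scale])
        (auto simp flip: power_Suc simp: Suc_diff_Suc)
    finally show ?thesis .
  qed
  \<comment> \<open>Telescoped form of (t - s) q(t) = p(t) - p(s); the boundary term disappears at k
    = m because v m = 0.\<close>
  have part: "scale (t - s) (\<Sum>j<k. scale (t ^ j) (v j)) =
      (\<Sum>j<k. scale (t ^ Suc j) (w (Suc j))) + scale (t ^ k * s) (v k) - scale s (v 0)"
    if "k \<le> m" for k t
    using that
  proof (induction k)
    case 0
    then show ?case by simp
  next
    case (Suc k)
    have "scale ((t - s) * t ^ k) (v k) = scale (t ^ Suc k) (v k) - scale (t ^ k * s) (v k)"
      by (simp add: algebra_simps)
    also have "scale (t ^ Suc k) (v k) = scale (t ^ Suc k) (w (Suc k)) + scale (t ^ Suc k * s) (v (Suc k))"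
      using Suc.prems by (subst v_rec) (auto simp: scale_right_distrib)
    finally show ?case using Suc by (simp add: scale_right_distrib)
  qed
  define p where "p t = (\<Sum>j<Suc m. scale (t ^ j) (w j))" for t
  have p: "p t = w 0 + (\<Sum>j<m. scale (t ^ Suc j) (w (Suc j)))" for t
    unfolding p_def by (subst sum.lessThan_Suc_shift) simp
  have p_eq: "p t = scale (t - s) (\<Sum>j<m. scale (t ^ j) (v j)) + (w 0 + scale s (v 0))" for t
    using part[of m t] v_top p[of t] by simp
  have ps: "p s = w 0 + scale s (v 0)" using p_eq[of s] by simp
  have pW: "p t \<in> W" if "t \<in> T" for t using Suc.prems(3)[OF that] by (simp add: p_def)
  have q: "(\<Sum>j<m. scale (t ^ j) (v j)) \<in> W" if t: "t \<in> T - {s}" for t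
  proof -
    have "scale (t - s) (\<Sum>j<m. scale (t ^ j) (v j)) = p t - p s"
      using p_eq[of t] ps by simp
    then have "scale (t - s) (\<Sum>j<m. scale (t ^ j) (v j)) \<in> W"
      using subspace_diff[OF W] pW t s by simp
    then have "scale (inverse (t - s)) (scale (t - s) (\<Sum>j<m. scale (t ^ j) (v j))) \<in> W"
      by (rule subspace_scale[OF W])
    then show ?thesis using t by simp
  qed
  have vW: "v j \<in> W" if "j < m" for j
    by (rule Suc.IH[of "T - {s}"]) (use Suc.prems s q that in \<open>auto simp: card_Diff_singleton\<close>)
  have vW': "v j \<in> W" if "j \<le> m" for j
    using vW v_top subspace_0[OF W] that by (cases "j = m") auto
  show ?case
  proof (cases k)
    case 0
    have "w 0 = p s - scale s (v 0)" using ps by simp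
    then show ?thesis
      using 0 pW[OF s] vW'[of 0] by (simp add: subspace_diff[OF W] subspace_scale[OF W])
  next
    case (Suc j)
    then have j: "j < m" using Suc.prems by simp
    then have "w k = v j - scale s (v (Suc j))" using v_rec[of j] Suc by simp
    then show ?thesis
      using j vW' by (simp add: subspace_diff[OF W] subspace_scale[OF W])
  qed
qed

definition lf :: "nat \<Rightarrow> 'a::field \<Rightarrow> 'a mpoly" where
  "lf n t = (\<Sum>j<n. smult (t ^ j) (Var j))"

lemma lf_in_Hom [simp]: "lf n t \<in> Hom n 1"
  unfolding lf_def by (intro mp.subspace_sum[OF subspace_Hom] Hom_closed Var_in_Hom) auto

lemma lf_mult: "lf n t * g = (\<Sum>j<n. smult (t ^ j) (Var j * g))"
  by (simp add: lf_def sum_distrib_right mult_smult_left)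

lemma MOST_ex: "\<forall>\<^sub>\<infinity>t::'a::field_char_0. P t \<Longrightarrow> \<exists>t. P t"
  using eventually_happens'[of cofinite P] by (auto simp: cofinite_bot infinite_UNIV_char_0)

lemma colon_add_multiples_subset:
  assumes "l \<in> Hom n 1" "l' \<in> Hom n 1"
  shows "add_multiples n k l' (colon n (Suc k) l V) \<subseteq> colon n (Suc k) l (add_multiples n (Suc k) l' V)"
  unfolding colon_def
proof (rule add_multiples_least)
  show "mp.subspace {g \<in> Hom n (Suc k). l * g \<in> add_multiples n (Suc k) l' V}"
    by (rule subspace_preimage_times[OF subspace_Hom subspace_add_multiples])
  show "{g \<in> Hom n (Suc k). l * g \<in> V} \<subseteq> {g \<in> Hom n (Suc k). l * g \<in> add_multiples n (Suc k) l' V}"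
    using add_multiples_upper(1)[of V] by auto
  fix g :: "'a mpoly" assume g: "g \<in> Hom n k"
  have "l * g \<in> Hom n (Suc k)" "l' * g \<in> Hom n (Suc k)"
    using Hom_mult'[OF assms(1) g] Hom_mult'[OF assms(2) g] by simp_all
  moreover from this(1) have "l * (l' * g) \<in> add_multiples n (Suc k) l' V"
    by (subst mult.left_commute) (rule add_multiples_upper(2))
  ultimately show "l' * g \<in> {g \<in> Hom n (Suc k). l * g \<in> add_multiples n (Suc k) l' V}"
    by simp
qed

lemma colon_mono: "V \<subseteq> W \<Longrightarrow> colon n i l V \<subseteq> colon n i l W"
  by (auto simp: colon_def)

text \<open>
  If the claim fails for infinitely many \<open>t\<close>, then for each of them the colon space has smaller
  codimension, so by induction \<open>l\<^sub>t R\<^sub>i \<subseteq> V + l\<^sub>s R\<^sub>i\<close> for generic \<open>s\<close>; and \<open>n\<close> of the \<open>l\<^sub>t\<close> span the linear forms.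
\<close>

lemma generic_add_multiples_eq_Hom:
  fixes V :: "'a::field_char_0 mpoly set"
  assumes "graded_subspace n (Suc i) V" "cod n (Suc i) V \<le> Suc i"
  shows "\<forall>\<^sub>\<infinity>t. add_multiples n i (lf n t) V = Hom n (Suc i)"
  using assms
proof (induction i arbitrary: V rule: less_induct)
  case (less i V)
  have sub: "mp.subspace V" using less.prems by (simp add: graded_subspace_def)
  show ?case
  proof (rule ccontr)
    assume neg: "\<not> ?case"
    then have "infinite {t. add_multiples n i (lf n t) V \<noteq> Hom n (Suc i)}"
      by (simp add: eventually_cofinite)
    then obtain T where T: "T \<subseteq> {t. add_multiples n i (lf n t) V \<noteq> Hom n (Suc i)}" "finite T" "card T = n"
      by (metis infinite_arbitrarily_large)
    have ev: "\<forall>\<^sub>\<infinity>s. \<forall>g\<in>Hom n i. lf n t * g \<in> add_multiples n i (lf n s) V" if t: "t \<in> T" for t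
    proof -
      let ?C = "colon n i (lf n t) V"
      have "cod n (Suc i) (add_multiples n i (lf n t) V) \<noteq> 0"
        using T(1) t cod_eq_0_iff[OF graded_subspace_add_multiples[OF less.prems(1) lf_in_Hom]] by auto
      then have C: "cod n i ?C \<le> i"
        using cod_colon_add_multiples[OF less.prems(1) lf_in_Hom[of n t]] less.prems(2) by linarith
      show ?thesis
      proof (cases i)
        case 0
        then have "?C = Hom n i" using C cod_eq_0_iff[OF graded_subspace_colon[OF sub]] by blast
        then have "\<forall>g\<in>Hom n i. lf n t * g \<in> V" by (auto simp: colon_def)
        then show ?thesis using add_multiples_upper(1) by (intro always_eventually) blast
      next
        case (Suc k)
        have "\<forall>\<^sub>\<infinity>s. add_multiples n k (lf n s) ?C = Hom n (Suc k)"
          using Suc C graded_subspace_colon[OF sub, of n i] by (intro less.IH) auto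
        then show ?thesis
        proof (rule eventually_mono)
          fix s assume "add_multiples n k (lf n s) ?C = Hom n (Suc k)"
          then have "Hom n i \<subseteq> colon n i (lf n t) (add_multiples n i (lf n s) V)"
            using colon_add_multiples_subset[OF lf_in_Hom[of n t] lf_in_Hom[of n s], of k V] Suc by simp
          then show "\<forall>g\<in>Hom n i. lf n t * g \<in> add_multiples n i (lf n s) V"
            by (auto simp: colon_def)
        qed
      qed
    qed
    have "\<forall>\<^sub>\<infinity>s. \<forall>t\<in>T. \<forall>g\<in>Hom n i. lf n t * g \<in> add_multiples n i (lf n s) V"
      using ev by (intro eventually_ball_finite T(2)) blast
    then have "\<forall>\<^sub>\<infinity>s. add_multiples n i (lf n s) V = Hom n (Suc i)"
    proof (rule eventually_mono)
      fix s assume s: "\<forall>t\<in>T. \<forall>g\<in>Hom n i. lf n t * g \<in> add_multiples n i (lf n s) V"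
      have "Hom n (Suc i) \<subseteq> add_multiples n i (lf n s) V"
      proof (rule Hom_Suc_subset_subspace[OF subspace_add_multiples])
        fix j and g :: "'a mpoly" assume "j < n" and g: "g \<in> Hom n i"
        then show "Var j * g \<in> add_multiples n i (lf n s) V"
          using s T(2,3) mp.coefficients_in_subspace[OF subspace_add_multiples, of T n "\<lambda>j. Var j * g" n i "lf n s" V j]
          by (simp add: lf_mult)
      qed
      then show "add_multiples n i (lf n s) V = Hom n (Suc i)"
        using graded_subspace_add_multiples[OF less.prems(1) lf_in_Hom[of n s]] by (auto simp: graded_subspace_def)
    qed
    then show False using neg by simp
  qed
qed

lemma add_multiples_commute: "add_multiples n i l (add_multiples n i l' V) = add_multiples n i l' (add_multiples n i l V)"
proof -
  have "add_multiples n i l (add_multiples n i l' V) \<subseteq> add_multiples n i l' (add_multiples n i l V)" for l l'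
  proof (rule add_multiples_least[OF subspace_add_multiples])
    show "add_multiples n i l' V \<subseteq> add_multiples n i l' (add_multiples n i l V)"
      using add_multiples_upper(1)[of V n i l] add_multiples_upper(1)[of "add_multiples n i l V" n i l']
      by (intro add_multiples_least subspace_add_multiples add_multiples_upper(2)) auto
    show "l * g \<in> add_multiples n i l' (add_multiples n i l V)" if "g \<in> Hom n i" for g
      using add_multiples_upper(2)[OF that] add_multiples_upper(1) by blast
  qed
  then show ?thesis by blast
qed

text \<open>The exact sequence for l on V + (l'), with the colon space replaced by the smaller (V :
  l) + (l'). Once l is fixed, both terms on the right are restrictions by l' of fixed spaces, so
  generic bounds apply to them; all sharper bounds below rest on this.\<close>

lemma cod_add_multiples_le_colon:
  assumes V: "graded_subspace n (Suc (Suc k)) V" and l: "l \<in> Hom n 1" "l' \<in> Hom n 1"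
  shows "cod n (Suc (Suc k)) (add_multiples n (Suc k) l' V)
    \<le> cod n (Suc (Suc k)) (add_multiples n (Suc k) l' (add_multiples n (Suc k) l V))
      + cod n (Suc k) (add_multiples n k l' (colon n (Suc k) l V))"
proof -
  have sub: "mp.subspace V" using V by (simp add: graded_subspace_def)
  note cod_colon_add_multiples[OF graded_subspace_add_multiples[OF V l(2)] l(1)]
  moreover have "cod n (Suc k) (colon n (Suc k) l (add_multiples n (Suc k) l' V))
      \<le> cod n (Suc k) (add_multiples n k l' (colon n (Suc k) l V))"
    by (intro cod_mono graded_subspace_add_multiples graded_subspace_colon colon_add_multiples_subset sub subspace_add_multiples l)
  ultimately show ?thesis by (simp add: add_multiples_commute[of n "Suc k" l])
qed

lemma graded_subspace_extend:
  assumes V: "graded_subspace n i V" and c: "cod n i V = Suc c"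
  obtains W where "graded_subspace n i W" "V \<subseteq> W" "cod n i W = c"
proof -
  have "V \<noteq> Hom n i" using c cod_eq_0_iff[OF V] by auto
  then obtain v where v: "v \<in> Hom n i" "v \<notin> V" using V by (auto simp: graded_subspace_def)
  define W where "W = mp.span (insert v V)"
  have W: "graded_subspace n i W"
    unfolding W_def graded_subspace_def using V v mp.span_minimal[OF _ subspace_Hom, of "insert v V" n i]
    by (simp add: graded_subspace_def)
  have VW: "V \<subseteq> W" unfolding W_def by (meson mp.span_superset subset_insertI subset_trans)
  have "v \<in> W" by (simp add: W_def mp.span_base)
  then have lt: "mp.dim V < mp.dim W"
    using graded_subspace_eq_of_dim_le[OF V W VW] v by (metis linorder_not_less)
  obtain F where F: "finite F" "(Hom n i :: 'a mpoly set) \<subseteq> mp.span F" by (rule Hom_finite_span)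
  obtain B where B: "B \<subseteq> V" "mp.independent B" "finite B" "mp.span B = V" "card B = mp.dim V"
    by (rule mp.finite_basis_exists[of V F]) (use V F in \<open>auto simp: graded_subspace_def\<close>)
  have "W \<subseteq> mp.span (insert v B)"
    unfolding W_def
    using mp.span_mono[OF subset_insertI, of B v] B(4)
    by (intro mp.span_minimal) (simp_all add: mp.span_base)
  then have "mp.dim W \<le> card (insert v B)" using B(3) by (intro mp.dim_le_card) auto
  also have "\<dots> \<le> Suc (mp.dim V)" using B by (simp add: card_insert_if)
  finally have "cod n i W = c" using lt c by (simp add: cod_def)
  then show ?thesis using that W VW by blast
qed

text \<open>Enlarging V by one vector also enlarges V : l, so the exact sequence lets the
  codimension of V + (l) drop by at most one. A bound valid up to codimension m thus extends with
  slope 1.\<close>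

lemma generic_cod_add_multiples_truncate:
  fixes V :: "'a::field_char_0 mpoly set"
  assumes base: "\<And>W :: 'a mpoly set. graded_subspace n (Suc i) W \<Longrightarrow> cod n (Suc i) W \<le> m \<Longrightarrow>
      \<forall>\<^sub>\<infinity>t. cod n (Suc i) (add_multiples n i (lf n t) W) \<le> q"
    and V: "graded_subspace n (Suc i) V"
  shows "\<forall>\<^sub>\<infinity>t. cod n (Suc i) (add_multiples n i (lf n t) V) \<le> q + (cod n (Suc i) V - m)"
  using V
proof (induction "cod n (Suc i) V - m" arbitrary: V)
  case 0
  then show ?case using base[OF 0(2)] by simp
next
  case (Suc c)
  then obtain c' where c': "cod n (Suc i) V = Suc c'" by (cases "cod n (Suc i) V") auto
  obtain W where W: "graded_subspace n (Suc i) W" "V \<subseteq> W" "cod n (Suc i) W = c'"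
    by (rule graded_subspace_extend[OF Suc.prems c'])
  have "\<forall>\<^sub>\<infinity>t. cod n (Suc i) (add_multiples n i (lf n t) W) \<le> q + (cod n (Suc i) W - m)"
    by (rule Suc.hyps(1)[OF _ W(1)]) (use Suc.hyps(2) W(3) c' in auto)
  then show ?case
  proof (rule eventually_mono)
    fix t assume t: "cod n (Suc i) (add_multiples n i (lf n t) W) \<le> q + (cod n (Suc i) W - m)"
    have "mp.subspace V" "mp.subspace W" using W(1) Suc.prems by (auto simp: graded_subspace_def)
    then have "cod n i (colon n i (lf n t) W) \<le> cod n i (colon n i (lf n t) V)"
      by (intro cod_mono graded_subspace_colon colon_mono W(2))
    then show "cod n (Suc i) (add_multiples n i (lf n t) V) \<le> q + (cod n (Suc i) V - m)"
      using t c' W(3) Suc.hyps(2) cod_colon_add_multiples[OF Suc.prems lf_in_Hom[of n t]]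
        cod_colon_add_multiples[OF W(1) lf_in_Hom[of n t]] by linarith
  qed
qed

lemma generic_cod_add_multiples:
  fixes V :: "'a::field_char_0 mpoly set"
  assumes "graded_subspace n (Suc i) V"
  shows "\<forall>\<^sub>\<infinity>t. cod n (Suc i) (add_multiples n i (lf n t) V) \<le> cod n (Suc i) V - Suc i"
proof -
  have "\<forall>\<^sub>\<infinity>t. cod n (Suc i) (add_multiples n i (lf n t) V) \<le> 0 + (cod n (Suc i) V - Suc i)"
  proof (rule generic_cod_add_multiples_truncate[OF _ assms])
    fix W :: "'a mpoly set" assume W: "graded_subspace n (Suc i) W" "cod n (Suc i) W \<le> Suc i"
    show "\<forall>\<^sub>\<infinity>t. cod n (Suc i) (add_multiples n i (lf n t) W) \<le> 0"
      using generic_add_multiples_eq_Hom[OF W] by (rule eventually_mono) (simp add: cod_def)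
  qed
  then show ?thesis by simp
qed

text \<open>In degree D = k + 2 the hypothesis reads codimension at most D + 2. A bad t with the
  weak bound has restriction of codimension exactly 2. Restricting once more by a generic s leaves 0
  from V + (l) and at most 1 from V : l.\<close>

lemma generic_cod_add_multiples_le_one:
  fixes V :: "'a::field_char_0 mpoly set"
  assumes V: "graded_subspace n (Suc (Suc k)) V" and c: "cod n (Suc (Suc k)) V \<le> k + 4"
  shows "\<forall>\<^sub>\<infinity>t. cod n (Suc (Suc k)) (add_multiples n (Suc k) (lf n t) V) \<le> 1"
proof (rule ccontr)
  let ?a = "\<lambda>t. cod n (Suc (Suc k)) (add_multiples n (Suc k) (lf n t) V)"
  assume "\<not> (\<forall>\<^sub>\<infinity>t. ?a t \<le> 1)"
  then have freq: "\<exists>\<^sub>\<infinity>t. \<not> ?a t \<le> 1" by (simp add: frequently_def)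
  then obtain t where t: "\<not> ?a t \<le> 1" "?a t \<le> cod n (Suc (Suc k)) V - Suc (Suc k)"
    using frequently_eventually_frequently[OF freq generic_cod_add_multiples[OF V]] frequently_ex by blast
  have sub: "mp.subspace V" using V by (simp add: graded_subspace_def)
  have codc: "cod n (Suc k) (colon n (Suc k) (lf n t) V) \<le> k + 2"
    using cod_colon_add_multiples[OF V lf_in_Hom[of n t]] t c by linarith
  have "\<forall>\<^sub>\<infinity>s. cod n (Suc (Suc k)) (add_multiples n (Suc k) (lf n s) (add_multiples n (Suc k) (lf n t) V)) \<le> ?a t - Suc (Suc k)"
    by (rule generic_cod_add_multiples[OF graded_subspace_add_multiples[OF V lf_in_Hom]])
  moreover have "\<forall>\<^sub>\<infinity>s. cod n (Suc k) (add_multiples n k (lf n s) (colon n (Suc k) (lf n t) V))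
      \<le> cod n (Suc k) (colon n (Suc k) (lf n t) V) - Suc k"
    by (rule generic_cod_add_multiples[OF graded_subspace_colon[OF sub]])
  ultimately have "\<forall>\<^sub>\<infinity>s. ?a s \<le> 1"
  proof eventually_elim
    case (elim s)
    then show ?case
      using cod_add_multiples_le_colon[OF V lf_in_Hom[of n t] lf_in_Hom[of n s]] codc t c by linarith
  qed
  then show False using freq by (simp add: frequently_def)
qed

lemma generic_cod_add_multiples_Suc:
  fixes V :: "'a::field_char_0 mpoly set"
  assumes "graded_subspace n (Suc (Suc k)) V"
  shows "\<forall>\<^sub>\<infinity>t. cod n (Suc (Suc k)) (add_multiples n (Suc k) (lf n t) V) \<le> 1 + (cod n (Suc (Suc k)) V - (k + 4))"
  by (rule generic_cod_add_multiples_truncate[OF generic_cod_add_multiples_le_one assms])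

text \<open>
  If \<open>t\<close> minimises the codimension among the infinitely many \<open>t\<close> violating the bound, the restriction
  inequality gives a strictly smaller value at generic \<open>s\<close>.
\<close>

lemma generic_cod_add_multiples_descent:
  fixes V :: "'a::field_char_0 mpoly set"
  assumes V: "graded_subspace n (Suc (Suc k)) V" and c: "cod n (Suc (Suc k)) V \<le> c + m" and m: "k + 4 \<le> m"
    and IH: "\<And>W :: 'a mpoly set. graded_subspace n (Suc k) W \<Longrightarrow> cod n (Suc k) W \<le> c \<Longrightarrow>
      \<forall>\<^sub>\<infinity>t. cod n (Suc k) (add_multiples n k (lf n t) W) \<le> k + 2"
  shows "\<forall>\<^sub>\<infinity>t. cod n (Suc (Suc k)) (add_multiples n (Suc k) (lf n t) V) < m"
proof (rule ccontr)
  let ?a = "\<lambda>t. cod n (Suc (Suc k)) (add_multiples n (Suc k) (lf n t) V)"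
  assume "\<not> (\<forall>\<^sub>\<infinity>t. ?a t < m)"
  then have freq: "\<exists>\<^sub>\<infinity>t. m \<le> ?a t" by (simp add: frequently_def not_le)
  then obtain t0 where "m \<le> ?a t0" using frequently_ex by blast
  then obtain t where t: "m \<le> ?a t" and min: "\<And>s. m \<le> ?a s \<Longrightarrow> ?a t \<le> ?a s"
    using ex_has_least_nat[of "\<lambda>t. m \<le> ?a t" t0 ?a] by blast
  have sub: "mp.subspace V" using V by (simp add: graded_subspace_def)
  have "cod n (Suc k) (colon n (Suc k) (lf n t) V) \<le> c"
    using cod_colon_add_multiples[OF V lf_in_Hom[of n t]] t c by linarith
  note IH[OF graded_subspace_colon[OF sub] this]
  moreover have "\<forall>\<^sub>\<infinity>s. cod n (Suc (Suc k)) (add_multiples n (Suc k) (lf n s) (add_multiples n (Suc k) (lf n t) V))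
      \<le> 1 + (?a t - (k + 4))"
    by (rule generic_cod_add_multiples_Suc[OF graded_subspace_add_multiples[OF V lf_in_Hom]])
  ultimately have "\<forall>\<^sub>\<infinity>s. ?a s < ?a t"
  proof eventually_elim
    case (elim s)
    \<comment> \<open>The constants just fit: as a t >= k + 4, the sum is at most 1 + (a t - (k +
      4)) + (k + 2) = a t - 1.\<close>
    then show ?case
      using cod_add_multiples_le_colon[OF V lf_in_Hom[of n t] lf_in_Hom[of n s]] t m by linarith
  qed
  then obtain s where "m \<le> ?a s" "?a s < ?a t"
    using frequently_eventually_frequently[OF freq] frequently_ex by blast
  then show False using min by fastforce
qed

text \<open>With D = i + 1, the numbers C(D+2,2) and D + 1 count the forms of degree D in three and
  in two variables; up to D - 1 further dimensions do not raise the generic restriction. The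
  thresholds for consecutive degrees differ by k + 4, which is the m of the descent.\<close>

lemma generic_cod_add_multiples_plane:
  fixes V :: "'a::field_char_0 mpoly set"
  assumes "graded_subspace n (Suc i) V" "cod n (Suc i) V \<le> (i + 3 choose 2) + i"
  shows "\<forall>\<^sub>\<infinity>t. cod n (Suc i) (add_multiples n i (lf n t) V) \<le> i + 2"
  using assms
proof (induction i arbitrary: V)
  case 0
  have "cod n (Suc 0) V \<le> 3" using 0 by (simp add: numeral_eq_Suc)
  then show ?case
    using generic_cod_add_multiples[OF 0(1)] by (elim eventually_mono) linarith
next
  case (Suc k)
  have "Suc k + 3 choose 2 = (k + 3) + (k + 3 choose 2)"
    by (simp add: numeral_eq_Suc)
  then have "cod n (Suc (Suc k)) V \<le> ((k + 3 choose 2) + k) + (k + 4)"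
    using Suc.prems(2) by linarith
  from generic_cod_add_multiples_descent[OF Suc.prems(1) this order_refl Suc.IH]
  show ?case by (rule eventually_mono) auto
qed

section \<open>Ideals truncated at a degree and Macaulay's bound\<close>

definition graded_ideal_upto :: "nat \<Rightarrow> nat \<Rightarrow> (nat \<Rightarrow> 'a::field mpoly set) \<Rightarrow> bool" where
  "graded_ideal_upto n D V \<longleftrightarrow> (\<forall>j\<le>D. graded_subspace n j (V j)) \<and>
     (\<forall>j<D. \<forall>l\<in>Hom n 1. \<forall>g\<in>V j. l * g \<in> V (Suc j))"

lemma graded_ideal_uptoD:
  assumes "graded_ideal_upto n D V"
  shows "j \<le> D \<Longrightarrow> graded_subspace n j (V j)" "j < D \<Longrightarrow> l \<in> Hom n 1 \<Longrightarrow> g \<in> V j \<Longrightarrow> l * g \<in> V (Suc j)"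
  using assms by (auto simp: graded_ideal_upto_def)

text \<open>The ideal V + (l); in degree 0 there are no multiples of l to add.\<close>

definition add_multiples_seq :: "nat \<Rightarrow> 'a::field mpoly \<Rightarrow> (nat \<Rightarrow> 'a mpoly set) \<Rightarrow> nat \<Rightarrow> 'a mpoly set" where
  "add_multiples_seq n l V j = (case j of 0 \<Rightarrow> V 0 | Suc k \<Rightarrow> add_multiples n k l (V (Suc k)))"

lemma graded_ideal_upto_add_multiples_seq:
  fixes V :: "nat \<Rightarrow> 'a::field mpoly set"
  assumes V: "graded_ideal_upto n D V" and l: "l \<in> Hom n 1"
  shows "graded_ideal_upto n D (add_multiples_seq n l V)"
  unfolding graded_ideal_upto_def
proof (intro conjI allI impI ballI)
  fix j assume "j \<le> D"
  then show "graded_subspace n j (add_multiples_seq n l V j)"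
    using graded_ideal_uptoD(1)[OF V] l by (cases j) (auto simp: add_multiples_seq_def graded_subspace_add_multiples)
next
  fix j and l' g :: "'a mpoly" assume j: "j < D" and l': "l' \<in> Hom n 1" and g: "g \<in> add_multiples_seq n l V j"
  show "l' * g \<in> add_multiples_seq n l V (Suc j)"
  proof (cases j)
    case 0
    then show ?thesis using g graded_ideal_uptoD(2)[OF V j l'] add_multiples_upper(1)[of "V (Suc 0)" n 0 l] by (auto simp: add_multiples_seq_def)
  next
    case (Suc k)
    have "add_multiples n k l (V j) \<subseteq> {g \<in> Hom n j. l' * g \<in> add_multiples n j l (V (Suc j))}"
    proof (rule add_multiples_least)
      show "mp.subspace {g \<in> Hom n j. l' * g \<in> add_multiples n j l (V (Suc j))}"
        by (rule subspace_preimage_times[OF subspace_Hom subspace_add_multiples])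
      show "V j \<subseteq> {g \<in> Hom n j. l' * g \<in> add_multiples n j l (V (Suc j))}"
        using graded_ideal_uptoD(1)[OF V, of j] graded_ideal_uptoD(2)[OF V j l'] j add_multiples_upper(1)[of "V (Suc j)" n j l]
        by (auto simp: graded_subspace_def)
      fix h :: "'a mpoly" assume h: "h \<in> Hom n k"
      have "l * h \<in> Hom n j" "l' * h \<in> Hom n j"
        using Hom_mult'[OF l h] Hom_mult'[OF l' h] Suc by simp_all
      moreover from this(2) have "l' * (l * h) \<in> add_multiples n j l (V (Suc j))"
        by (subst mult.left_commute) (rule add_multiples_upper(2))
      ultimately show "l * h \<in> {g \<in> Hom n j. l' * g \<in> add_multiples n j l (V (Suc j))}"
        by simp
    qed
    then show ?thesis using g Suc by (auto simp: add_multiples_seq_def)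
  qed
qed

text \<open>An ideal satisfies V j <= (V (j + 1) : l), so the exact sequence bounds the growth of
  the Hilbert function by the restriction to l.\<close>

lemma cod_Suc_le:
  assumes V: "graded_ideal_upto n D V" and j: "j < D" and l: "l \<in> Hom n 1"
  shows "cod n (Suc j) (V (Suc j)) \<le> cod n j (V j) + cod n (Suc j) (add_multiples n j l (V (Suc j)))"
proof -
  have g: "graded_subspace n (Suc j) (V (Suc j))" "graded_subspace n j (V j)" using graded_ideal_uptoD(1)[OF V] j by auto
  have "V j \<subseteq> colon n j l (V (Suc j))"
    using graded_ideal_uptoD(2)[OF V j l] g(2) by (auto simp: colon_def graded_subspace_def)
  then have "cod n j (colon n j l (V (Suc j))) \<le> cod n j (V j)"
    using g by (intro cod_mono graded_subspace_colon) (auto simp: graded_subspace_def)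
  then show ?thesis using cod_colon_add_multiples[OF g(1) l] by linarith
qed

lemma add_multiples_eq_Hom_mono:
  fixes V :: "nat \<Rightarrow> 'a::field mpoly set"
  assumes V: "graded_ideal_upto n D V" and l: "l \<in> Hom n 1" and "i \<le> j" "j < D"
    and "add_multiples n i l (V (Suc i)) = Hom n (Suc i)"
  shows "add_multiples n j l (V (Suc j)) = Hom n (Suc j)"
  using assms(3,4)
proof (induction j rule: dec_induct)
  case base
  then show ?case using assms by simp
next
  case (step j)
  have "graded_ideal_upto n D (add_multiples_seq n l V)" by (rule graded_ideal_upto_add_multiples_seq[OF V l])
  note G = graded_ideal_uptoD[OF this]
  have "Hom n (Suc (Suc j)) \<subseteq> add_multiples n (Suc j) l (V (Suc (Suc j)))"
  proof (rule Hom_Suc_subset_subspace[OF subspace_add_multiples])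
    fix x and g :: "'a mpoly" assume "x < n" "g \<in> Hom n (Suc j)"
    then show "Var x * g \<in> add_multiples n (Suc j) l (V (Suc (Suc j)))"
      using G(2)[OF _ Var_in_Hom, of "Suc j" x g] step by (simp add: add_multiples_seq_def)
  qed
  moreover have "add_multiples n (Suc j) l (V (Suc (Suc j))) \<subseteq> Hom n (Suc (Suc j))"
    using G(1)[of "Suc (Suc j)"] step by (simp add: add_multiples_seq_def graded_subspace_def)
  ultimately show ?case by blast
qed

text \<open>A generic l leaves nothing of the quotient in degree i + 1, hence nothing in higher
  degrees, so from there on multiplication by l is surjective from each degree to the next.\<close>

lemma cod_nonincreasing:
  fixes V :: "nat \<Rightarrow> 'a::field_char_0 mpoly set"
  assumes V: "graded_ideal_upto n D V" and c: "cod n (Suc i) (V (Suc i)) \<le> Suc i" and ij: "Suc i \<le> j" "j \<le> D"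
  shows "cod n j (V j) \<le> cod n (Suc i) (V (Suc i))"
proof -
  have "\<forall>\<^sub>\<infinity>t. add_multiples n i (lf n t) (V (Suc i)) = Hom n (Suc i)"
    using ij c by (intro generic_add_multiples_eq_Hom graded_ideal_uptoD(1)[OF V]) auto
  then obtain t where t: "add_multiples n i (lf n t) (V (Suc i)) = Hom n (Suc i)"
    using MOST_ex by blast
  show ?thesis
    using ij
  proof (induction j rule: dec_induct)
    case (step j)
    have "add_multiples n j (lf n t) (V (Suc j)) = Hom n (Suc j)"
      using step by (intro add_multiples_eq_Hom_mono[OF V lf_in_Hom _ _ t]) auto
    then have "cod n (Suc j) (V (Suc j)) \<le> cod n j (V j)"
      using cod_Suc_le[OF V _ lf_in_Hom[of n t], of j] step by (simp add: cod_def)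
    then show ?case using step by simp
  qed simp
qed

section \<open>Gorenstein duality and the numerical induction\<close>

text \<open>
  With \<open>H = I\<^sub>d\<close> a hyperplane in degree \<open>d\<close>, this is \<open>I\<^sub>i\<close> for the Gorenstein ideal \<open>I\<close> with dual socle
  generator defining \<open>H\<close>; passing to \<open>I : l\<close> just replaces \<open>H\<close> by \<open>H : l\<close>.
\<close>

definition perp :: "nat \<Rightarrow> nat \<Rightarrow> 'a::field mpoly set \<Rightarrow> nat \<Rightarrow> 'a mpoly set" where
  "perp n d H i = {g \<in> Hom n i. \<forall>h\<in>Hom n (d - i). g * h \<in> H}"

lemma subspace_preimages_times:
  assumes "mp.subspace R" "mp.subspace H"
  shows "mp.subspace {g \<in> R. \<forall>h\<in>C. h * g \<in> H}"
  using assms unfolding mp.subspace_def by (auto simp: distrib_left mult_smult_right)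

text \<open>As H has codimension at most 1, each h in C imposes at most one linear
  condition.\<close>

lemma dim_le_preimages_card:
  assumes H: "graded_subspace n d H" "cod n d H \<le> 1" and R: "graded_subspace n i R" and i: "i \<le> d"
    and C: "finite C" "C \<subseteq> Hom n (d - i)"
  shows "mp.dim R \<le> mp.dim {g \<in> R. \<forall>h\<in>C. h * g \<in> H} + card C"
  using C
proof (induction C rule: finite_induct)
  case empty
  then show ?case by simp
next
  case (insert h C)
  let ?P = "{g \<in> R. \<forall>h\<in>C. h * g \<in> H}"
  have P: "graded_subspace n i ?P"
    using subspace_preimages_times[of R H C] R H(1) by (auto simp: graded_subspace_def)
  have "h * g \<in> Hom n d" if "g \<in> ?P" for g
    using that P insert.prems i by (intro Hom_mult'[of h n "d - i" g i]) (auto simp: graded_subspace_def)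
  then have "H \<union> (*) h ` ?P \<subseteq> Hom n d" using H(1) by (auto simp: graded_subspace_def)
  then have "graded_subspace n d (mp.span (H \<union> (*) h ` ?P))"
    unfolding graded_subspace_def by (simp add: mp.span_minimal subspace_Hom)
  then have "mp.dim (mp.span (H \<union> (*) h ` ?P)) \<le> mp.dim H + 1"
    using H(2) graded_subspace_dim_le unfolding cod_def by fastforce
  then have "mp.dim ?P \<le> mp.dim {g \<in> ?P. h * g \<in> H} + 1"
    using dim_preimage_times[OF H(1) P, of h] by linarith
  moreover have "{g \<in> ?P. h * g \<in> H} = {g \<in> R. \<forall>h\<in>insert h C. h * g \<in> H}" by auto
  ultimately show ?case using insert by simp
qed

lemma graded_subspace_perp:
  assumes "graded_subspace n d H" shows "graded_subspace n i (perp n d H i)"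
  using subspace_preimages_times[OF subspace_Hom, of H n i "Hom n (d - i)"] assms
  unfolding graded_subspace_def perp_def by (auto simp: mult.commute)

text \<open>The multiplication pairing into degree d modulo H has the two \<open>perp\<close> spaces
  as kernels. Applied in both directions this gives the symmetry of the Hilbert function.\<close>

lemma cod_perp_le:
  assumes H: "graded_subspace n d H" "cod n d H \<le> 1" and i: "i \<le> d"
  shows "cod n i (perp n d H i) \<le> cod n (d - i) (perp n d H (d - i))"
proof -
  let ?j = "d - i" let ?N = "perp n d H (d - i)"
  obtain F where F: "finite F" "(Hom n ?j :: 'a mpoly set) \<subseteq> mp.span F" by (rule Hom_finite_span)
  have N: "mp.subspace ?N" "?N \<subseteq> Hom n ?j" using graded_subspace_perp[OF H(1)] by (auto simp: graded_subspace_def)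
  obtain A where A: "A \<subseteq> ?N" "mp.independent A" "finite A" "mp.span A = ?N" "card A = mp.dim ?N"
    by (rule mp.finite_basis_exists[OF N(1) order_trans[OF N(2) F(2)] F(1)])
  obtain B where B: "A \<subseteq> B" "B \<subseteq> Hom n ?j" "mp.independent B" "finite B" "mp.span B = Hom n ?j"
      "card B = mp.dim (Hom n ?j :: 'a mpoly set)"
    by (rule mp.finite_basis_extend[OF subspace_Hom F(2,1) A(2) order_trans[OF A(1) N(2)]])
  have H': "mp.subspace H" using H by (simp add: graded_subspace_def)
  \<comment> \<open>Elements of A pair into H with everything, so only the basis vectors outside A
    impose conditions.\<close>
  have "{g \<in> Hom n i. \<forall>h\<in>B - A. h * g \<in> H} \<subseteq> perp n d H i"
  proof
    fix g assume g: "g \<in> {g \<in> Hom n i. \<forall>h\<in>B - A. h * g \<in> H}"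
    have "B \<subseteq> {h \<in> Hom n ?j. g * h \<in> H}"
    proof
      fix h assume h: "h \<in> B"
      have "h * g \<in> H"
      proof (cases "h \<in> A")
        case True
        then show ?thesis using A(1) g i by (auto simp: perp_def)
      next
        case False
        then show ?thesis using g h by auto
      qed
      then show "h \<in> {h \<in> Hom n ?j. g * h \<in> H}" using h B(2) by (auto simp: mult.commute)
    qed
    then have "mp.span B \<subseteq> {h \<in> Hom n ?j. g * h \<in> H}"
      by (rule mp.span_minimal) (rule subspace_preimage_times[OF subspace_Hom H'])
    then show "g \<in> perp n d H i" using g B(5) by (auto simp: perp_def)
  qed
  moreover have "graded_subspace n i {g \<in> Hom n i. \<forall>h\<in>B - A. h * g \<in> H}"
    using subspace_preimages_times[OF subspace_Hom H'] by (auto simp: graded_subspace_def)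
  ultimately have "mp.dim {g \<in> Hom n i. \<forall>h\<in>B - A. h * g \<in> H} \<le> mp.dim (perp n d H i)"
    using graded_subspace_dim_mono graded_subspace_perp[OF H(1)] by blast
  moreover have "mp.dim (Hom n i :: 'a mpoly set) \<le> mp.dim {g \<in> Hom n i. \<forall>h\<in>B - A. h * g \<in> H} + card (B - A)"
    using B by (intro dim_le_preimages_card[OF H graded_subspace_Hom i]) auto
  moreover have "card (B - A) = cod n ?j ?N"
    unfolding cod_def using A B by (metis card_Diff_subset)
  ultimately show ?thesis unfolding cod_def by linarith
qed

lemma cod_perp_symm:
  assumes "graded_subspace n d H" "cod n d H \<le> 1" "i \<le> d"
  shows "cod n (d - i) (perp n d H (d - i)) = cod n i (perp n d H i)"
  using cod_perp_le[OF assms] cod_perp_le[OF assms(1,2), of "d - i"] assms(3) by simp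

text \<open>The cut-off at d is essential: beyond it d - i truncates to 0, and \<open>perp\<close>
  keeps only members of H of the wrong degree.\<close>

lemma graded_ideal_upto_perp:
  fixes H :: "'a::field mpoly set"
  assumes "graded_subspace n d H" shows "graded_ideal_upto n d (perp n d H)"
  unfolding graded_ideal_upto_def
proof (intro conjI allI impI ballI graded_subspace_perp assms)
  fix j and l g :: "'a mpoly" assume j: "j < d" and l: "l \<in> Hom n 1" and g: "g \<in> perp n d H j"
  have "l * g \<in> Hom n (Suc j)" using Hom_mult'[OF l, of g j] g by (auto simp: perp_def)
  moreover have "l * g * h \<in> H" if h: "h \<in> Hom n (d - Suc j)" for h
  proof -
    have "l * h \<in> Hom n (d - j)" using j by (intro Hom_mult'[OF l h]) auto
    then have "g * (l * h) \<in> H" using g by (auto simp: perp_def)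
    then show ?thesis by (simp add: ac_simps)
  qed
  ultimately show "l * g \<in> perp n d H (Suc j)" by (auto simp: perp_def)
qed

text \<open>The product g (l h) lies in H iff g h lies in H : l. So A/(0 : l) is again given by a
  hyperplane, one degree lower.\<close>

lemma colon_perp:
  assumes l: "l \<in> Hom n 1" and i: "i \<le> e"
  shows "colon n i l (perp n (Suc e) H (Suc i)) = perp n e (colon n e l H) i"
proof -
  have "l * g \<in> perp n (Suc e) H (Suc i) \<longleftrightarrow> (\<forall>h\<in>Hom n (e - i). g * h \<in> colon n e l H)"
    if g: "g \<in> Hom n i" for g
  proof -
    have "l * g \<in> Hom n (Suc i)" using Hom_mult'[OF l g] by simp
    moreover have "g * h \<in> Hom n e" if "h \<in> Hom n (e - i)" for h
      using i by (intro Hom_mult'[OF g that]) auto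
    ultimately show ?thesis by (auto simp: perp_def colon_def mult.assoc)
  qed
  then show ?thesis unfolding colon_def[of n i] perp_def[of n e] by auto
qed

section \<open>The numerical induction on the socle degree\<close>

lemma choose_2_Suc: "Suc k choose 2 = k + (k choose 2)"
  by (simp add: numeral_2_eq_2)

text \<open>Counts the monomials in three variables of degree i and of degree d - i. It models the
  Hilbert function only for 1 <= i < d; at the ends it exceeds 1.\<close>

definition perazzo_hilb :: "nat \<Rightarrow> nat \<Rightarrow> nat" where
  "perazzo_hilb d i = (i + 2 choose 2) + (d - i + 2 choose 2)"

lemma gorenstein_minimal:
  fixes H :: "'a::field_char_0 mpoly set"
  assumes "d \<ge> 3" "graded_subspace n d H" "cod n d H \<le> 1"
    and "cod n 1 (perp n d H 1) = (d + 1 choose 2) + 3"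
    and "\<And>i. 1 \<le> i \<Longrightarrow> i < d \<Longrightarrow> cod n i (perp n d H i) \<le> perazzo_hilb d i"
    and "1 \<le> i" "i < d"
  shows "cod n i (perp n d H i) = perazzo_hilb d i"
  using assms
proof (induction d arbitrary: H i rule: dec_induct)
  case base
  have "i = 1 \<or> i = 2" using base by auto
  moreover have "cod n 2 (perp n 3 H 2) = cod n 1 (perp n 3 H 1)"
    using cod_perp_symm[of n 3 H 1] base by simp
  ultimately show ?case
    using base(3) by (auto simp: perazzo_hilb_def numeral_eq_Suc)
next
  case (step e)
  note H = step.prems(1,2)
  let ?N = "perp n (Suc e) H"
  define h where "h i = cod n i (?N i)" for i
  have N: "graded_ideal_upto n (Suc e) ?N" by (rule graded_ideal_upto_perp[OF H(1)])
  have h1: "h 1 = (e + 2 choose 2) + 3" using step.prems(3) by (simp add: h_def)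
  have h_le: "h i \<le> perazzo_hilb (Suc e) i" if "1 \<le> i" "i \<le> e" for i
    using step.prems(4)[of i] that by (simp add: h_def)
  have he: "h e = h 1" using cod_perp_symm[OF H, of 1] by (simp add: h_def)
  obtain k where k: "e = Suc k" "k \<ge> 2" using step.hyps by (cases e) auto
  \<comment> \<open>The restriction bound in degree e. For e = 3 the value h 3 = 13 exceeds the
    threshold C(5,2) + 2 = 12 of the plane bound, and the descent with 13 = 7 + 6 gives 5.\<close>
  define m where "m = (if e = 3 then 5 else e + 1)"
  have "\<forall>\<^sub>\<infinity>t. cod n (Suc k) (add_multiples n k (lf n t) (?N (Suc k))) \<le> m"
  proof (cases "e = 3")
    case True
    then have k2: "k = Suc 1" using k by simp
    have c: "cod n (Suc (Suc 1)) (?N (Suc (Suc 1))) \<le> ((1 + 3 choose 2) + 1) + 6"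
      using he h1 k True unfolding h_def k2 by (simp add: numeral_eq_Suc)
    have "\<forall>\<^sub>\<infinity>t. cod n (Suc (Suc 1)) (add_multiples n (Suc 1) (lf n t) (?N (Suc (Suc 1)))) < 6"
      by (rule generic_cod_add_multiples_descent[OF graded_subspace_perp[OF H(1)] c _ generic_cod_add_multiples_plane]) auto
    then show ?thesis unfolding k2 m_def by (rule eventually_mono) (use True in simp)
  next
    case False
    then have "k \<ge> 3" using k by simp
    moreover have "e + 2 choose 2 = k + 3 choose 2" using k by (simp add: numeral_eq_Suc)
    ultimately have "h e \<le> (k + 3 choose 2) + k" using he h1 by linarith
    then have "\<forall>\<^sub>\<infinity>t. cod n (Suc k) (add_multiples n k (lf n t) (?N (Suc k))) \<le> k + 2"
      using k by (intro generic_cod_add_multiples_plane graded_subspace_perp H) (simp add: h_def)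
    then show ?thesis using False k by (simp add: m_def)
  qed
  then obtain t where t: "cod n (Suc k) (add_multiples n k (lf n t) (?N (Suc k))) \<le> m"
    using MOST_ex by blast
  define A where "A = add_multiples_seq n (lf n t) ?N"
  define a where "a i = cod n i (A i)" for i
  have A: "graded_ideal_upto n (Suc e) A" unfolding A_def by (rule graded_ideal_upto_add_multiples_seq[OF N lf_in_Hom])
  have ae: "a e \<le> m" using t k by (simp add: a_def A_def add_multiples_seq_def)
  define H' where "H' = colon n e (lf n t) H"
  define b where "b i = cod n i (perp n e H' i)" for i
  \<comment> \<open>The induction carries codimension at most 1, because passing to a colon space
    can only lower it.\<close>
  have H': "graded_subspace n e H'" "cod n e H' \<le> 1"
    using H cod_colon_add_multiples[OF H(1) lf_in_Hom[of n t]] graded_subspace_colon[of H] by (auto simp: H'_def graded_subspace_def)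
  have hba: "h (Suc i) = b i + a (Suc i)" if "i \<le> e" for i
    using cod_colon_add_multiples[OF graded_subspace_perp[OF H(1)] lf_in_Hom[of n t], of i] colon_perp[OF lf_in_Hom[of n t] that, of H]
    by (simp add: h_def b_def a_def A_def add_multiples_seq_def H'_def)
  have b_sym: "b k = b 1" using cod_perp_symm[OF H', of 1] k by (simp add: b_def)
  \<comment> \<open>Both symmetries meet here: h e = h 1 for A and b k = b 1 for B. Together with
    \<open>h2_eq\<close> this gives h 1 - h 2 = a e - a 2.\<close>
  have h1_eq: "h 1 = b 1 + a e" using hba[of k] he k b_sym by simp
  have h2_eq: "h 2 = b 1 + a 2" using hba[of 1] step.hyps by (simp add: numeral_2_eq_2)
  have flat: "a e \<le> a i" if "a i \<le> i" "1 \<le> i" "i \<le> e" for i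
    using cod_nonincreasing[OF A, of "i - 1" e] that by (simp add: a_def)
  show ?case
  proof (cases "e = 3")
    case True
    have h1': "h 1 = 13" using h1 True by (simp add: numeral_eq_Suc)
    \<comment> \<open>If h 2 <= 11, then a 2 <= 11 - 13 + 5 = 3. A second generic form then leaves
      dimension at most 1 in degree 2, hence also in degree 3, so a 3 <= a 2 + 1. But a 3 - a 2 = h
      1 - h 2 would be at least 2.\<close>
    have "h 2 \<ge> 12"
    proof (rule ccontr)
      assume "\<not> h 2 \<ge> 12"
      then have a2: "a 2 \<le> 3" using h1_eq h2_eq h1' ae True by (simp add: m_def)
      have "\<forall>\<^sub>\<infinity>s. cod n (Suc 1) (add_multiples n 1 (lf n s) (A (Suc 1))) \<le> cod n (Suc 1) (A (Suc 1)) - Suc 1"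
        using True by (intro generic_cod_add_multiples graded_ideal_uptoD(1)[OF A]) simp
      then obtain s where s: "cod n (Suc 1) (add_multiples n 1 (lf n s) (A (Suc 1))) \<le> cod n (Suc 1) (A (Suc 1)) - Suc 1"
        using MOST_ex by blast
      define A' where "A' = add_multiples_seq n (lf n s) A"
      have A': "graded_ideal_upto n (Suc e) A'" unfolding A'_def by (rule graded_ideal_upto_add_multiples_seq[OF A lf_in_Hom])
      have 1: "cod n (Suc 1) (A' (Suc 1)) \<le> 1"
        using s a2 by (simp add: A'_def add_multiples_seq_def a_def numeral_2_eq_2)
      then have "cod n 3 (A' 3) \<le> cod n (Suc 1) (A' (Suc 1))"
        using True by (intro cod_nonincreasing[OF A']) auto
      then have "cod n (Suc 2) (add_multiples n 2 (lf n s) (A (Suc 2))) \<le> 1"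
        using 1 by (simp add: A'_def add_multiples_seq_def numeral_eq_Suc)
      then have "a 3 \<le> a 2 + 1"
        using cod_Suc_le[OF A _ lf_in_Hom[of n s], of 2] True by (simp add: a_def)
      then show False using h1_eq h2_eq h1' \<open>\<not> h 2 \<ge> 12\<close> True by simp
    qed
    moreover have "h 2 \<le> 12" using h_le[of 2] True by (simp add: perazzo_hilb_def numeral_eq_Suc)
    ultimately have "h 2 = 12" by simp
    moreover have "i = 1 \<or> i = 2 \<or> i = 3" using step.prems True by auto
    ultimately have "h i = perazzo_hilb (Suc e) i"
      using h1' he True by (auto simp: perazzo_hilb_def numeral_eq_Suc)
    then show ?thesis by (simp add: h_def)
  next
    case False
    then have e4: "e \<ge> 4" using step.hyps by simp
    have ch: "e + 2 choose 2 = (e + 1) + (e + 1 choose 2)"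
      using choose_2_Suc[of "e + 1"] by simp
    have h2_le: "h 2 \<le> 6 + (e + 1 choose 2)"
      using h_le[of 2] e4 by (simp add: perazzo_hilb_def numeral_eq_Suc Suc_diff_Suc)
    \<comment> \<open>The bound on a e leaves B at least the degree 1 value that the claim for socle
      degree e starts from.\<close>
    have b1_ge: "b 1 \<ge> (e + 1 choose 2) + 3" using ae h1_eq h1 ch False by (simp add: m_def)
    then have "a 2 \<le> 3" using h2_eq h2_le by linarith
    \<comment> \<open>Otherwise \<open>flat\<close> gives a e <= a 2 and so h 1 <= h 2, although h 1
      exceeds the upper bound on h 2 by e - 2.\<close>
    moreover have "\<not> a 2 \<le> 2"
      using flat[of 2] h1_eq h2_eq h2_le h1 ch e4 by linarith
    ultimately have a2: "a 2 = 3" by simp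
    then have b1: "b 1 = (e + 1 choose 2) + 3" using b1_ge h2_eq h2_le by linarith
    have "a e = e + 1" using h1_eq h1 ch b1 by linarith
    \<comment> \<open>If a i <= i, then \<open>flat\<close> would give e + 1 = a e <= i <=
      e.\<close>
    then have a_ge: "a i \<ge> i + 1" if "1 \<le> i" "i \<le> e" for i
      using flat[of i] that by linarith
    have rel: "perazzo_hilb (Suc e) (Suc i) = perazzo_hilb e i + (i + 2)" for i
      using choose_2_Suc[of "i + 2"] by (simp add: perazzo_hilb_def)
    have b_le: "b i \<le> perazzo_hilb e i" if "1 \<le> i" "i < e" for i
      using h_le[of "Suc i"] hba[of i] a_ge[of "Suc i"] rel[of i] that by simp
    have b_eq: "b i = perazzo_hilb e i" if "1 \<le> i" "i < e" for i
      unfolding b_def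
      by (rule step.IH[OF H']) (use b1 b_le that in \<open>auto simp: b_def\<close>)
    show ?thesis
    proof (cases "i = 1")
      case True
      then show ?thesis using h1 e4 by (simp add: h_def perazzo_hilb_def numeral_eq_Suc)
    next
      case False
      then obtain j where j: "i = Suc j" "1 \<le> j" "j < e" using step.prems by (cases i) auto
      then have "h i \<ge> perazzo_hilb (Suc e) i"
        using hba[of j] b_eq[of j] a_ge[of "Suc j"] rel[of j] by simp
      moreover have "h i \<le> perazzo_hilb (Suc e) i" using h_le[of i] j by simp
      ultimately show ?thesis by (simp add: h_def)
    qed
  qed
qed

section \<open>Annihilator ideals are Gorenstein\<close>

lemma Pol_mult:
  assumes "p \<in> Pol n" "q \<in> Pol n" shows "p * q \<in> Pol n"
  unfolding Pol_def
proof (safe)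
  fix m k assume m: "m \<in> Poly_Mapping.keys (p * q)" "k \<in> Poly_Mapping.keys m"
  then obtain a b where "m = a + b" "a \<in> Poly_Mapping.keys p" "b \<in> Poly_Mapping.keys q"
    using keys_mult[of p q] by blast
  then show "k < n" using m(2) assms by (fastforce simp: Pol_def keys_add_nat)
qed

lemma Hom_subset_Pol: "p \<in> Hom n i \<Longrightarrow> p \<in> Pol n"
  by (simp add: Hom_def)

lemma hom_idealD:
  assumes "hom_ideal n I"
  shows "I \<subseteq> Pol n" "p \<in> I \<Longrightarrow> q \<in> Pol n \<Longrightarrow> q * p \<in> I" "mp.subspace I"
proof -
  have mult: "q * p \<in> I" if "p \<in> I" "q \<in> Pol n" for p q
    using assms that by (auto simp: hom_ideal_def)
  then show "p \<in> I \<Longrightarrow> q \<in> Pol n \<Longrightarrow> q * p \<in> I" .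
  have "smult c p \<in> I" if "p \<in> I" for c p
    using mult[OF that, of "Poly_Mapping.single 0 c"] by (simp add: smult_eq_mult Pol_def)
  then show "mp.subspace I"
    using assms by (auto simp: mp.subspace_def hom_ideal_def)
qed (use assms in \<open>auto simp: hom_ideal_def\<close>)

lemma hom_ideal_soc:
  assumes I: "hom_ideal n I"
  shows "graded_subspace n i (I \<inter> Hom n i)" "graded_subspace n i (soc n I \<inter> Hom n i)" "I \<inter> Hom n i \<subseteq> soc n I \<inter> Hom n i"
proof -
  note sub = hom_idealD(3)[OF I]
  show "graded_subspace n i (I \<inter> Hom n i)"
    by (simp add: graded_subspace_def mp.subspace_inter sub subspace_Hom)
  have "soc n I \<inter> Hom n i = {p \<in> Hom n i. \<forall>h\<in>Var ` {..<n}. h * p \<in> I}"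
    by (auto simp: soc_def Hom_subset_Pol)
  then show "graded_subspace n i (soc n I \<inter> Hom n i)"
    using subspace_preimages_times[OF subspace_Hom sub, of n i "Var ` {..<n}"] by (simp add: graded_subspace_def)
  show "I \<inter> Hom n i \<subseteq> soc n I \<inter> Hom n i"
  proof
    fix p assume p: "p \<in> I \<inter> Hom n i"
    then have "Var j * p \<in> I" if "j < n" for j
      using hom_idealD(2)[OF I _ Hom_subset_Pol[OF Var_in_Hom[OF that]]] by blast
    then show "p \<in> soc n I \<inter> Hom n i" using p by (auto simp: soc_def Hom_subset_Pol)
  qed
qed

lemma soc_top:
  assumes "Hom n (Suc d) \<subseteq> I" shows "soc n I \<inter> Hom n d = Hom n d"
proof -
  have "Var j * p \<in> I" if "j < n" "p \<in> Hom n d" for j p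
    using Hom_mult'[OF Var_in_Hom[OF that(1)] that(2)] assms by auto
  then show ?thesis by (auto simp: soc_def Hom_subset_Pol)
qed

lemma hilb_eq_cod: "hilb n I i = cod n i (I \<inter> Hom n i)"
  by (simp add: hilb_def cod_def vdim_eq_dim)

text \<open>A Gorenstein ideal is recovered from its top degree piece, which brings the ideals of
  the theorem under \<open>gorenstein_minimal\<close>.\<close>

lemma AG_perp:
  fixes I :: "'a::field mpoly set"
  assumes AG: "AG n I d"
  defines "H \<equiv> I \<inter> Hom n d"
  shows "graded_subspace n d H" "cod n d H = 1" "i \<le> d \<Longrightarrow> I \<inter> Hom n i = perp n d H i"
proof -
  have I: "hom_ideal n I" and top: "\<And>i. i > d \<Longrightarrow> Hom n i \<subseteq> I" and ntop: "\<not> Hom n d \<subseteq> I"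
    and sum: "(\<Sum>i\<le>d. vdim (soc n I \<inter> Hom n i) - vdim (I \<inter> Hom n i)) = 1"
    using AG by (auto simp: AG_def)
  show H: "graded_subspace n d H" unfolding H_def by (rule hom_ideal_soc(1)[OF I])
  define T where "T i = vdim (soc n I \<inter> Hom n i) - vdim (I \<inter> Hom n i)" for i
  have "T d = cod n d H"
    using soc_top[of n d I] top[of "Suc d"] by (simp add: T_def cod_def H_def vdim_eq_dim)
  moreover have "cod n d H \<noteq> 0" using cod_eq_0_iff[OF H] ntop by (auto simp: H_def)
  moreover have split: "T d + sum T ({..d} - {d}) = 1"
    using sum sum.remove[of "{..d}" d T] by (simp add: T_def)
  \<comment> \<open>The summand at d is at least 1, so it uses up the whole sum and the socle
    vanishes below degree d.\<close>
  ultimately have c: "cod n d H = 1" and zero: "sum T ({..d} - {d}) = 0" by linarith+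
  show "cod n d H = 1" by (rule c)
  have soc: "soc n I \<inter> Hom n j \<subseteq> I" if "j < d" for j
  proof -
    have "T j = 0" using zero that by (simp add: sum_nonneg_eq_0_iff)
    then have "I \<inter> Hom n j = soc n I \<inter> Hom n j"
      by (intro graded_subspace_eq_of_dim_le[of n j] hom_ideal_soc[OF I]) (simp add: T_def vdim_eq_dim)
    then show ?thesis by blast
  qed
  \<comment> \<open>Downward induction from d: the multiples of g by variables are already in I, so
    g represents a socle element of degree below d, which is zero.\<close>
  have "perp n d H i \<subseteq> I" if "i \<le> d" for i
    using that
  proof (induction i rule: inc_induct)
    case base
    have "(1 :: 'a mpoly) \<in> Hom n 0" by (auto simp: Hom_def Pol_def)
    then show ?case by (force simp: perp_def H_def)
  next
    case (step i)
    show ?case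
    proof
      fix g assume g: "g \<in> perp n d H i"
      then have "Var j * g \<in> I" if "j < n" for j
        using graded_ideal_uptoD(2)[OF graded_ideal_upto_perp[OF H] step.hyps(2) Var_in_Hom[OF that] g] step.IH by blast
      moreover have "g \<in> Hom n i" using g by (simp add: perp_def)
      ultimately show "g \<in> I" using soc[OF step.hyps(2)] by (auto simp: soc_def Hom_subset_Pol)
    qed
  qed
  moreover have "g * h \<in> H" if "g \<in> I" "g \<in> Hom n i" "i \<le> d" "h \<in> Hom n (d - i)" for g h i
    using hom_idealD(2)[OF I that(1) Hom_subset_Pol[OF that(4)]] Hom_mult'[OF that(2,4)] that(3)
    by (simp add: H_def mult.commute)
  ultimately show "I \<inter> Hom n i = perp n d H i" if "i \<le> d"
    using that by (fastforce simp: perp_def)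
qed

lemma AG_hilb_ends:
  assumes AG: "AG n I d"
  shows "hilb n I 0 = 1" "hilb n I d = 1" "i > d \<Longrightarrow> hilb n I i = 0"
proof -
  note P = AG_perp[OF AG]
  show d: "hilb n I d = 1" using P(2) by (simp add: hilb_eq_cod)
  show "hilb n I 0 = 1"
    using cod_perp_symm[OF P(1), of 0] P(2) P(3)[of 0] P(3)[of d] by (simp add: hilb_eq_cod)
  show "hilb n I i = 0" if "i > d"
    using AG that by (auto simp: AG_def hilb_eq_cod cod_def Int_absorb1)
qed

lemma AG_minimal:
  fixes I :: "'a::field_char_0 mpoly set"
  assumes AG: "AG n I d" and d: "d \<ge> 3" and h1: "hilb n I 1 = 3 + (d + 1 choose 2)"
    and le: "\<And>i. 1 \<le> i \<Longrightarrow> i < d \<Longrightarrow> hilb n I i \<le> perazzo_hilb d i"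
    and i: "1 \<le> i" "i < d"
  shows "hilb n I i = perazzo_hilb d i"
proof -
  note P = AG_perp[OF AG]
  have eq: "hilb n I j = cod n j (perp n d (I \<inter> Hom n d) j)" if "j \<le> d" for j
    using P(3)[OF that] by (simp add: hilb_eq_cod)
  have h1': "cod n 1 (perp n d (I \<inter> Hom n d) 1) = (d + 1 choose 2) + 3"
    using h1 eq[of 1] d by simp
  have le': "cod n j (perp n d (I \<inter> Hom n d) j) \<le> perazzo_hilb d j" if "1 \<le> j" "j < d" for j
    using le[OF that] eq[of j] that by simp
  have "cod n i (perp n d (I \<inter> Hom n d) i) = perazzo_hilb d i"
    by (rule gorenstein_minimal[OF d P(1) eq_refl[OF P(2)] h1' le' i])
  then show ?thesis using eq i by simp
qed

section \<open>Differentiation as a pairing\<close>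

definition mfac :: "(nat \<Rightarrow>\<^sub>0 nat) \<Rightarrow> 'a::field_char_0" where
  "mfac m = (\<Prod>k\<in>Poly_Mapping.keys m. fact (Poly_Mapping.lookup m k))"

lemma mfac_nonzero [simp]: "mfac m \<noteq> (0 :: 'a::field_char_0)"
  by (simp add: mfac_def)

lemma mfac_add_single:
  "mfac (m + Poly_Mapping.single k 1) = of_nat (Poly_Mapping.lookup m k + 1) * (mfac m :: 'a::field_char_0)"
proof -
  have ext: "mfac m' = (\<Prod>j\<in>insert k (Poly_Mapping.keys m). fact (Poly_Mapping.lookup m' j) :: 'a)"
    if "Poly_Mapping.keys m' \<subseteq> insert k (Poly_Mapping.keys m)" for m'
    unfolding mfac_def using that by (intro prod.mono_neutral_left) (auto simp: in_keys_iff)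
  have "Poly_Mapping.keys (m + Poly_Mapping.single k 1) \<subseteq> insert k (Poly_Mapping.keys m)"
    by (auto simp: keys_add_nat)
  then have "mfac (m + Poly_Mapping.single k 1) =
      fact (Suc (Poly_Mapping.lookup m k)) * (\<Prod>j\<in>insert k (Poly_Mapping.keys m) - {k}.
        fact (Poly_Mapping.lookup (m + Poly_Mapping.single k 1) j) :: 'a)"
    by (simp add: ext prod.remove[of "insert k (Poly_Mapping.keys m)" k] lookup_add)
  also have "(\<Prod>j\<in>insert k (Poly_Mapping.keys m) - {k}.
        fact (Poly_Mapping.lookup (m + Poly_Mapping.single k 1) j) :: 'a)
      = (\<Prod>j\<in>insert k (Poly_Mapping.keys m) - {k}. fact (Poly_Mapping.lookup m j))"
    by (intro prod.cong) (auto simp: lookup_add lookup_single when_def)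
  finally show ?thesis
    using ext[of m] prod.remove[of "insert k (Poly_Mapping.keys m)" k "\<lambda>j. fact (Poly_Mapping.lookup m j) :: 'a"]
    by (simp add: algebra_simps subset_insertI)
qed

lemma lookup_pderiv:
  "Poly_Mapping.lookup (pderiv k p) m =
    of_nat (Poly_Mapping.lookup m k + 1) * Poly_Mapping.lookup p (m + Poly_Mapping.single k 1)"
proof -
  have "finite ((\<lambda>m. m + Poly_Mapping.single k 1) -` Poly_Mapping.keys p)"
    by (intro finite_vimageI) (auto simp: inj_on_def)
  then have "finite {m. of_nat (Poly_Mapping.lookup m k + 1) *
      Poly_Mapping.lookup p (m + Poly_Mapping.single k 1) \<noteq> 0}"
    by (rule rev_finite_subset) (auto simp: in_keys_iff)
  then show ?thesis unfolding pderiv_def by (simp add: lookup_Abs_poly_mapping)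
qed

text \<open>Weighting coefficients by factorials, as in divided powers, turns derivatives into
  shifts of exponents. In characteristic 0 the weights are invertible.\<close>

lemma lookup_pderiv_mfac:
  fixes p :: "'a::field_char_0 mpoly"
  shows "Poly_Mapping.lookup (pderiv k p) m * mfac m =
    Poly_Mapping.lookup p (m + Poly_Mapping.single k 1) * mfac (m + Poly_Mapping.single k 1)"
  by (simp add: lookup_pderiv mfac_add_single del: One_nat_def)

lemma lookup_pderiv_pow_mfac:
  fixes p :: "'a::field_char_0 mpoly"
  shows "Poly_Mapping.lookup ((pderiv k ^^ r) p) m * mfac m =
    Poly_Mapping.lookup p (m + Poly_Mapping.single k r) * mfac (m + Poly_Mapping.single k r)"
proof (induction r arbitrary: m)
  case (Suc r)
  have "m + Poly_Mapping.single k 1 + Poly_Mapping.single k r = m + Poly_Mapping.single k (Suc r)"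
    by (simp add: add.assoc flip: single_add)
  then show ?case using Suc[of "m + Poly_Mapping.single k 1"] by (simp add: lookup_pderiv_mfac del: One_nat_def)
qed simp

lemma lookup_dmono_mfac:
  fixes p :: "'a::field_char_0 mpoly"
  shows "Poly_Mapping.lookup (dmono \<alpha> p) m * mfac m = Poly_Mapping.lookup p (m + \<alpha>) * mfac (m + \<alpha>)"
proof -
  have *: "Poly_Mapping.lookup (foldr (\<lambda>k g. (pderiv k ^^ Poly_Mapping.lookup \<alpha> k) \<circ> g) ks id p) m * mfac m
    = Poly_Mapping.lookup p (m + (\<Sum>k\<leftarrow>ks. Poly_Mapping.single k (Poly_Mapping.lookup \<alpha> k)))
      * mfac (m + (\<Sum>k\<leftarrow>ks. Poly_Mapping.single k (Poly_Mapping.lookup \<alpha> k)))" for ks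
    by (induction ks arbitrary: m) (simp_all add: lookup_pderiv_pow_mfac add.assoc)
  have "(\<Sum>k\<leftarrow>sorted_list_of_set (Poly_Mapping.keys \<alpha>). Poly_Mapping.single k (Poly_Mapping.lookup \<alpha> k)) = \<alpha>"
    by (simp add: sum_list_distinct_conv_sum_set sum_single_lookup)
  with *[of "sorted_list_of_set (Poly_Mapping.keys \<alpha>)"] show ?thesis by (simp add: dmono_def)
qed

text \<open>The constant term of \<open>act q F\<close>, as \<open>lookup_act_mfac\<close> shows at
  m = 0.\<close>

definition pair :: "'a::field_char_0 mpoly \<Rightarrow> 'a mpoly \<Rightarrow> 'a" where
  "pair F q = (\<Sum>\<alpha>\<in>Poly_Mapping.keys q. Poly_Mapping.lookup q \<alpha> * (Poly_Mapping.lookup F \<alpha> * mfac \<alpha>))"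

lemma pair_eq_sum:
  assumes "finite S" "Poly_Mapping.keys q \<subseteq> S"
  shows "pair F q = (\<Sum>\<alpha>\<in>S. Poly_Mapping.lookup q \<alpha> * (Poly_Mapping.lookup F \<alpha> * mfac \<alpha>))"
  unfolding pair_def using assms by (intro sum.mono_neutral_left) (auto simp: in_keys_iff)

lemma pair_zero [simp]: "pair F 0 = 0"
  by (simp add: pair_def)

lemma pair_add: "pair F (p + q) = pair F p + pair F q"
proof -
  let ?S = "Poly_Mapping.keys p \<union> Poly_Mapping.keys q"
  have "Poly_Mapping.keys (p + q) \<subseteq> ?S" by (rule keys_add)
  then show ?thesis
    by (simp add: pair_eq_sum[of ?S] lookup_add distrib_right sum.distrib)
qed

lemma pair_smult: "pair F (smult c p) = c * pair F p"
proof -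
  have "Poly_Mapping.keys (smult c p) \<subseteq> Poly_Mapping.keys p" by (auto simp: in_keys_iff)
  then show ?thesis
    by (simp add: pair_eq_sum[of "Poly_Mapping.keys p"] sum_distrib_left mult.assoc)
qed

lemma pair_sum: "pair F (sum g S) = (\<Sum>x\<in>S. pair F (g x))"
  by (induction S rule: infinite_finite_induct) (simp_all add: pair_add)

lemma pair_single: "pair F (Poly_Mapping.single \<alpha> c) = c * (Poly_Mapping.lookup F \<alpha> * mfac \<alpha>)"
  by (simp add: pair_eq_sum[of "{\<alpha>}"])

lemma pair_mult_single:
  assumes "finite S" "Poly_Mapping.keys q \<subseteq> S"
  shows "pair F (q * Poly_Mapping.single m 1) =
    (\<Sum>\<alpha>\<in>S. Poly_Mapping.lookup q \<alpha> * (Poly_Mapping.lookup F (\<alpha> + m) * mfac (\<alpha> + m)))"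
proof -
  have "q * Poly_Mapping.single m 1 = (\<Sum>\<alpha>\<in>S. Poly_Mapping.single (\<alpha> + m) (Poly_Mapping.lookup q \<alpha>))"
    by (subst sum_single_lookup[OF assms, symmetric]) (simp add: sum_distrib_right mult_single)
  then show ?thesis by (simp add: pair_sum pair_single)
qed

lemma smult_single: "smult c (Poly_Mapping.single m 1) = Poly_Mapping.single m c"
  by (simp add: smult_eq_mult mult_single)

lemma pair_mult_eq_0:
  assumes "\<And>m. pair F (q * Poly_Mapping.single m 1) = 0"
  shows "pair F (q * p) = 0"
proof -
  have "q * p = (\<Sum>m\<in>Poly_Mapping.keys p. smult (Poly_Mapping.lookup p m) (q * Poly_Mapping.single m 1))"
    by (subst sum_single_lookup[of "Poly_Mapping.keys p" p, symmetric])
      (simp_all add: sum_distrib_left smult_single flip: mult_smult_right)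
  then show ?thesis using assms by (simp add: pair_sum pair_smult)
qed

text \<open>
  Up to the factor \<open>m!\<close>, the coefficient at \<open>m\<close> of \<open>q\<close> acting on \<open>F\<close> is the value at \<open>q x\<^sup>m\<close> of one linear
  functional; this makes the ideal property of the annihilator evident.
\<close>

lemma lookup_act_mfac:
  "Poly_Mapping.lookup (act q F) m * mfac m = pair F (q * Poly_Mapping.single m 1)"
  unfolding act_def lookup_sum sum_distrib_right
  by (subst pair_mult_single[of "Poly_Mapping.keys q"])
    (auto simp: mult.assoc lookup_dmono_mfac add.commute intro!: sum.cong)

lemma Ann_iff_pair:
  "q \<in> Ann n F \<longleftrightarrow> q \<in> Pol n \<and> (\<forall>m. pair F (q * Poly_Mapping.single m 1) = 0)"
proof -
  have "act q F = 0 \<longleftrightarrow> (\<forall>m. Poly_Mapping.lookup (act q F) m * mfac m = 0)"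
    by (auto intro: poly_mapping_eqI)
  then show ?thesis by (simp add: Ann_def lookup_act_mfac)
qed

lemma Ann_pair_mult: "q \<in> Ann n F \<Longrightarrow> pair F (q * p) = 0"
  by (simp add: Ann_iff_pair pair_mult_eq_0)

lemma lookup_hcomp:
  "Poly_Mapping.lookup (hcomp i p) m = (if mdeg m = i then Poly_Mapping.lookup p m else 0)"
proof -
  have "finite {m. (if mdeg m = i then Poly_Mapping.lookup p m else 0) \<noteq> 0}"
    by (rule finite_subset[of _ "Poly_Mapping.keys p"]) (auto simp: in_keys_iff)
  then show ?thesis unfolding hcomp_def by (simp add: lookup_Abs_poly_mapping)
qed

lemma lookup_Hom_eq_0: "F \<in> Hom n d \<Longrightarrow> mdeg m \<noteq> d \<Longrightarrow> Poly_Mapping.lookup F m = 0"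
  by (auto simp: Hom_def in_keys_iff)

lemma hom_ideal_Ann:
  fixes F :: "'a::field_char_0 mpoly"
  assumes F: "F \<in> Hom n d" shows "hom_ideal n (Ann n F)"
  unfolding hom_ideal_def
proof (intro conjI ballI allI)
  show "Ann n F \<subseteq> Pol n" by (auto simp: Ann_def)
  show "0 \<in> Ann n F" by (simp add: Ann_iff_pair Pol_def)
  fix p assume p: "p \<in> Ann n F"
  show "p + q \<in> Ann n F" if "q \<in> Ann n F" for q
    using p that keys_add[of p q] by (fastforce simp: Ann_iff_pair distrib_right pair_add Pol_def)
  show "q * p \<in> Ann n F" if "q \<in> Pol n" for q
    using p that Ann_pair_mult[OF p] by (auto simp: Ann_iff_pair mult.assoc mult.left_commute[of q] Pol_mult)
  fix i
  have keys: "Poly_Mapping.keys (hcomp i p) \<subseteq> Poly_Mapping.keys p"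
    by (auto simp: in_keys_iff lookup_hcomp split: if_splits)
  have "pair F (hcomp i p * Poly_Mapping.single m 1) = 0" for m
  proof (cases "i + mdeg m = d")
    case True
    have "pair F (hcomp i p * Poly_Mapping.single m 1) = pair F (p * Poly_Mapping.single m 1)"
      using True keys
      by (subst (1 2) pair_mult_single[of "Poly_Mapping.keys p"])
        (auto intro!: sum.cong simp: lookup_hcomp lookup_Hom_eq_0[OF F] mdeg_add split: if_splits)
    then show ?thesis using p by (simp add: Ann_iff_pair)
  next
    case False
    then show ?thesis
      using keys by (subst pair_mult_single[of "Poly_Mapping.keys p"])
        (auto intro!: sum.neutral simp: lookup_hcomp lookup_Hom_eq_0[OF F] mdeg_add)
  qed
  moreover have "hcomp i p \<in> Pol n" using p keys by (auto simp: Ann_def Pol_def)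
  ultimately show "hcomp i p \<in> Ann n F" by (simp add: Ann_iff_pair)
qed

text \<open>The functional becomes the endomorphism sending g to \<phi> g times 1, so that
  \<open>dim_span_Un_image\<close> applies with V = 0 and an image inside the line spanned by
  1.\<close>

lemma dim_le_kernel:
  assumes R: "graded_subspace n i R" and add: "\<And>p q. \<phi> (p + q) = \<phi> p + \<phi> q" and sc: "\<And>c p. \<phi> (smult c p) = c * \<phi> p"
  shows "mp.dim R \<le> mp.dim {g \<in> R. \<phi> g = 0} + 1"
proof -
  have hom: "module_hom smult smult (\<lambda>g. smult (\<phi> g) 1)"
    unfolding module_hom_iff by (simp add: mp.module_axioms add sc mp.scale_left_distrib)
  obtain F where F: "finite F" "(Hom n i :: 'a mpoly set) \<subseteq> mp.span F" by (rule Hom_finite_span)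
  have "{0} \<union> (\<lambda>g. smult (\<phi> g) 1) ` R \<subseteq> mp.span {1}"
    by (auto simp: mp.span_zero mp.span_scale mp.span_base)
  then have "mp.span ({0} \<union> (\<lambda>g. smult (\<phi> g) 1) ` R) \<subseteq> mp.span {1}"
    by (rule mp.span_minimal) simp
  then have "mp.dim (mp.span ({0} \<union> (\<lambda>g. smult (\<phi> g) 1) ` R)) \<le> card {1 :: 'a mpoly}"
    by (rule mp.dim_le_card) simp
  moreover have "mp.dim (mp.span ({0} \<union> (\<lambda>g. smult (\<phi> g) 1) ` R)) + mp.dim {g \<in> R. smult (\<phi> g) 1 \<in> {0}}
      = mp.dim {0 :: 'a mpoly} + mp.dim R"
    by (rule mp.dim_span_Un_image[OF hom, where F = F and G = "{}"])
      (use R F in \<open>auto simp: graded_subspace_def\<close>)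
  ultimately show ?thesis by simp
qed

lemma dim_le_kernels:
  assumes R: "graded_subspace n i R" and K: "finite K"
    and add: "\<And>k p q. \<phi> k (p + q) = \<phi> k p + \<phi> k q" and sc: "\<And>k c p. \<phi> k (smult c p) = c * \<phi> k p"
  shows "graded_subspace n i {g \<in> R. \<forall>k\<in>K. \<phi> k g = 0} \<and>
    mp.dim R \<le> mp.dim {g \<in> R. \<forall>k\<in>K. \<phi> k g = 0} + card K"
  using K
proof (induction K rule: finite_induct)
  case empty
  then show ?case using R by simp
next
  case (insert k K)
  let ?P = "{g \<in> R. \<forall>k\<in>K. \<phi> k g = 0}"
  have eq: "{g \<in> R. \<forall>k\<in>insert k K. \<phi> k g = 0} = {g \<in> ?P. \<phi> k g = 0}" by auto
  have "\<phi> k 0 = 0" using sc[of k 0 0] by simp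
  then have "graded_subspace n i {g \<in> ?P. \<phi> k g = 0}"
    using insert.IH by (auto simp: graded_subspace_def mp.subspace_def add sc)
  moreover have "mp.dim ?P \<le> mp.dim {g \<in> ?P. \<phi> k g = 0} + 1"
    using insert.IH dim_le_kernel[of n i ?P "\<phi> k"] add sc by blast
  ultimately show ?case using insert unfolding eq by simp
qed

lemma AG_Ann:
  fixes F :: "'a::field_char_0 mpoly"
  assumes F: "F \<in> Hom n d" "F \<noteq> 0" shows "AG n (Ann n F) d"
proof -
  let ?I = "Ann n F"
  have I: "hom_ideal n ?I" by (rule hom_ideal_Ann[OF F(1)])
  have top: "Hom n i \<subseteq> ?I" if "i > d" for i
  proof
    fix q :: "'a mpoly" assume q: "q \<in> Hom n i"
    have "pair F (q * Poly_Mapping.single m 1) = 0" for m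
      using q that by (subst pair_mult_single[of "Poly_Mapping.keys q"])
        (auto intro!: sum.neutral lookup_Hom_eq_0[OF F(1)] simp: Hom_def mdeg_add)
    then show "q \<in> ?I" using q by (simp add: Ann_iff_pair Hom_subset_Pol)
  qed
  obtain \<alpha> where \<alpha>: "\<alpha> \<in> Poly_Mapping.keys F" using F(2) by (metis all_not_in_conv keys_eq_empty)
  have sH: "Poly_Mapping.single \<alpha> 1 \<in> Hom n d"
    using \<alpha> F(1) by (intro single_in_Hom) (auto simp: Hom_def Pol_def)
  have "pair F (Poly_Mapping.single \<alpha> 1 * 1) \<noteq> 0"
    using \<alpha> by (simp add: pair_single in_keys_iff)
  then have sI: "Poly_Mapping.single \<alpha> 1 \<notin> ?I" using Ann_pair_mult by blast
  let ?T = "\<lambda>i. vdim (soc n ?I \<inter> Hom n i) - vdim (?I \<inter> Hom n i)"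
  have low: "?T i = 0" if i: "i < d" for i
  proof -
    have "soc n ?I \<inter> Hom n i \<subseteq> ?I"
    proof
      fix p assume p: "p \<in> soc n ?I \<inter> Hom n i"
      have "pair F (p * Poly_Mapping.single m 1) = 0" for m
      \<comment> \<open>Here m ranges over monomials in all variables. One of the first n variables
        can be moved over to p, where the socle condition applies. Without such a variable F has no
        matching coefficient: by degree if m = 0, and otherwise because F involves only the first n
        variables.\<close>
      proof (cases "Poly_Mapping.keys m \<inter> {..<n} = {}")
        case True
        have "Poly_Mapping.lookup F (\<beta> + m) = 0" if "\<beta> \<in> Poly_Mapping.keys p" for \<beta>
        proof (cases "m = 0")
          case True
          then show ?thesis using that p i by (intro lookup_Hom_eq_0[OF F(1)]) (auto simp: Hom_def)
        next
          case False
          then obtain k where "k \<in> Poly_Mapping.keys m" by (metis all_not_in_conv keys_eq_empty)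
          then have "\<not> Poly_Mapping.keys (\<beta> + m) \<subseteq> {..<n}" using True by (auto simp: keys_add_nat)
          then show ?thesis using F(1) by (auto simp: Hom_def Pol_def in_keys_iff)
        qed
        then show ?thesis by (simp add: pair_mult_single[of "Poly_Mapping.keys p"])
      next
        case False
        then obtain k where k: "k \<in> Poly_Mapping.keys m" "k < n" by auto
        have "p * Poly_Mapping.single m 1 =
            p * (Var k * Poly_Mapping.single (m - Poly_Mapping.single k 1) 1)"
          using single_add_diff[OF k(1)] by (simp add: Var_def mult_single)
        also have "\<dots> = (Var k * p) * Poly_Mapping.single (m - Poly_Mapping.single k 1) 1"
          by (simp add: ac_simps)
        finally show ?thesis
          using p k Ann_pair_mult[of "Var k * p" n F] by (simp only: soc_def Int_iff mem_Collect_eq)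
      qed
      then show "p \<in> ?I" using p by (auto simp: Ann_iff_pair Hom_subset_Pol)
    qed
    then have "soc n ?I \<inter> Hom n i = ?I \<inter> Hom n i" using hom_ideal_soc(3)[OF I, of i] by blast
    then show ?thesis by simp
  qed
  have "?T d = cod n d (?I \<inter> Hom n d)"
    using soc_top[of n d ?I] top[of "Suc d"] by (simp add: cod_def vdim_eq_dim)
  moreover have "cod n d (?I \<inter> Hom n d) \<noteq> 0"
    using cod_eq_0_iff[OF hom_ideal_soc(1)[OF I]] sH sI by blast
  moreover have "cod n d (?I \<inter> Hom n d) \<le> 1"
  proof -
    \<comment> \<open>In degree d only the functional \<open>pair F\<close> matters, since a further
      monomial factor overshoots the degree of F.\<close>
    have "{g \<in> Hom n d. pair F g = 0} \<subseteq> ?I \<inter> Hom n d"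
    proof safe
      fix g assume g: "g \<in> Hom n d" "pair F g = 0"
      have "pair F (g * Poly_Mapping.single m 1) = 0" for m
      proof (cases "m = 0")
        case True
        then show ?thesis using g by simp
      next
        case False
        then have "mdeg m \<noteq> 0" by (simp add: mdeg_eq_0_iff)
        then have "Poly_Mapping.lookup F (\<beta> + m) = 0" if "\<beta> \<in> Poly_Mapping.keys g" for \<beta>
          using that g(1) by (intro lookup_Hom_eq_0[OF F(1)]) (simp add: Hom_def mdeg_add)
        then show ?thesis by (simp add: pair_mult_single[of "Poly_Mapping.keys g"])
      qed
      then show "g \<in> ?I" using g by (simp add: Ann_iff_pair Hom_subset_Pol)
    qed
    moreover have "graded_subspace n d {g \<in> Hom n d. pair F g = 0}"
      "mp.dim (Hom n d :: 'a mpoly set) \<le> mp.dim {g \<in> Hom n d. pair F g = 0} + 1"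
      using dim_le_kernels[OF graded_subspace_Hom[of n d], of "{()}" "\<lambda>_. pair F"] by (simp_all add: pair_add pair_smult)
    ultimately have "mp.dim (Hom n d :: 'a mpoly set) \<le> mp.dim (?I \<inter> Hom n d) + 1"
      using graded_subspace_dim_mono[OF _ hom_ideal_soc(1)[OF I, of d]] by (meson add_le_mono1 order_trans)
    then show ?thesis by (simp add: cod_def)
  qed
  ultimately have "?T d = 1" by linarith
  moreover have "(\<Sum>i\<le>d. ?T i) = (\<Sum>i\<in>{d}. ?T i)"
    using low by (intro sum.mono_neutral_right) auto
  ultimately have "(\<Sum>i\<le>d. ?T i) = 1" by simp
  then show ?thesis unfolding AG_def using I top sH sI by blast
qed

section \<open>Full Perazzo polynomials\<close>

lemma card_simplex_le: "finite {(a, b). a + b \<le> k} \<and> card {(a, b). a + b \<le> (k::nat)} \<le> k + 2 choose 2"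
proof (induction k)
  case 0
  have "{(a, b). a + b \<le> (0::nat)} = {(0, 0)}" by auto
  then show ?case by (simp add: numeral_2_eq_2)
next
  case (Suc k)
  have eq: "{(a, b). a + b \<le> Suc k} = {(a, b). a + b \<le> k} \<union> (\<lambda>a. (a, Suc k - a)) ` {..Suc k}"
    by (auto simp: le_Suc_eq image_iff)
  have "card {(a, b). a + b \<le> Suc k} \<le> card {(a, b). a + b \<le> k} + card ((\<lambda>a. (a, Suc k - a)) ` {..Suc k})"
    unfolding eq by (rule card_Un_le)
  also have "\<dots> \<le> (k + 2 choose 2) + (k + 2)"
    using Suc card_image_le[of "{..Suc k}" "\<lambda>a. (a, Suc k - a)"] by simp
  also have "\<dots> = Suc k + 2 choose 2"
    using choose_2_Suc[of "k + 2"] by simp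
  finally show ?case using Suc eq by simp
qed

text \<open>The degree determines the third exponent, so the first two embed the monomials into the
  simplex counted above.\<close>

lemma card_monomials3_le:
  fixes x :: nat
  shows "card {m. Poly_Mapping.keys m \<subseteq> {x, x + 1, x + 2} \<and> mdeg m = k} \<le> k + 2 choose 2"
proof -
  let ?M = "{m. Poly_Mapping.keys m \<subseteq> {x, x + 1, x + 2} \<and> mdeg m = k}"
  let ?g = "\<lambda>m. (Poly_Mapping.lookup m x, Poly_Mapping.lookup m (x + 1))"
  have deg: "Poly_Mapping.lookup m x + Poly_Mapping.lookup m (x + 1) + Poly_Mapping.lookup m (x + 2) = k"
    if "m \<in> ?M" for m
    using that mdeg_eq_sum[of "{x, x + 1, x + 2}" m] by simp
  have "inj_on ?g ?M"
  proof (rule inj_onI)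
    fix m m' assume m: "m \<in> ?M" "m' \<in> ?M" "?g m = ?g m'"
    show "m = m'"
    proof (rule poly_mapping_eqI)
      fix j
      show "Poly_Mapping.lookup m j = Poly_Mapping.lookup m' j"
      proof (cases "j \<in> {x, x + 1, x + 2}")
        case True
        then show ?thesis using m deg[OF m(1)] deg[OF m(2)] by auto
      next
        case False
        then have "j \<notin> Poly_Mapping.keys m" "j \<notin> Poly_Mapping.keys m'" using m by auto
        then show ?thesis by (simp add: in_keys_iff)
      qed
    qed
  qed
  moreover have "?g m \<in> {(a, b). a + b \<le> k}" if "m \<in> ?M" for m using deg[OF that] by simp
  then have "?g ` ?M \<subseteq> {(a, b). a + b \<le> k}" by (rule image_subsetI)
  ultimately have "card ?M \<le> card {(a, b). a + b \<le> k}"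
    by (rule card_inj_on_le) (simp add: card_simplex_le)
  then show ?thesis using card_simplex_le[of k] by linarith
qed

text \<open>Variables below \<tau> are the x_j, the next three are the u's, and
  \<open>enum j\<close> is the exponent of M_j. The locale lets the lemmas share the assumptions of
  the theorem.\<close>

locale full_perazzo =
  fixes d \<tau> :: nat and enum :: "nat \<Rightarrow> (nat \<Rightarrow>\<^sub>0 nat)" and f :: "'a::field_char_0 mpoly"
  assumes tau: "\<tau> = (d + 1) choose 2" and d4: "d \<ge> 4"
    and enum: "bij_betw enum {..<\<tau>}
                 {m. Poly_Mapping.keys m \<subseteq> {\<tau>, \<tau>+1, \<tau>+2} \<and> mdeg m = d - 1}"
    and f: "f = (\<Sum>j<\<tau>. Poly_Mapping.single (Poly_Mapping.single j 1 + enum j) 1)"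
begin

abbreviation uvars :: "nat set" where
  "uvars \<equiv> {\<tau>, \<tau> + 1, \<tau> + 2}"

lemma enumD:
  assumes "j < \<tau>" shows "Poly_Mapping.keys (enum j) \<subseteq> uvars" "mdeg (enum j) = d - 1"
  using bij_betwE[OF enum] assms by auto

lemma lookup_enum: "j < \<tau> \<Longrightarrow> k < \<tau> \<Longrightarrow> Poly_Mapping.lookup (enum j) k = 0"
  using enumD(1)[of j] by (fastforce simp: in_keys_iff)

lemma term_eqD:
  assumes "j < \<tau>" "j' < \<tau>" "Poly_Mapping.single j 1 + enum j = Poly_Mapping.single j' 1 + enum j'"
  shows "j = j'"
  using lookup_enum[of j j] lookup_enum[of j' j] assms(1,2)
    arg_cong[OF assms(3), of "\<lambda>m. Poly_Mapping.lookup m j"]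
  by (auto simp: lookup_add lookup_single when_def split: if_splits)

lemma lookup_f:
  "Poly_Mapping.lookup f m = (if \<exists>j<\<tau>. m = Poly_Mapping.single j 1 + enum j then 1 else 0)"
proof (cases "\<exists>j<\<tau>. m = Poly_Mapping.single j 1 + enum j")
  case True
  then obtain j where j: "j < \<tau>" "m = Poly_Mapping.single j 1 + enum j" by blast
  have "Poly_Mapping.lookup f m = (\<Sum>j'<\<tau>. if j' = j then 1 else 0)"
    unfolding f lookup_sum
    by (intro sum.cong refl) (use j term_eqD in \<open>auto simp: lookup_single when_def simp del: One_nat_def\<close>)
  then show ?thesis using j True by simp
next
  case False
  then have "Poly_Mapping.lookup f m = 0"
    unfolding f lookup_sum by (intro sum.neutral) (auto simp: lookup_single when_def)
  then show ?thesis using False by simp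
qed

lemma f_in_Hom: "f \<in> Hom (\<tau> + 3) d"
  unfolding f
proof (intro mp.subspace_sum[OF subspace_Hom] single_in_Hom)
  fix j assume "j \<in> {..<\<tau>}"
  then show "Poly_Mapping.keys (Poly_Mapping.single j 1 + enum j) \<subseteq> {..<\<tau> + 3}"
    "mdeg (Poly_Mapping.single j 1 + enum j) = d"
    using enumD[of j] d4 by (auto simp: keys_add_nat mdeg_add)
qed

lemma f_nonzero: "f \<noteq> 0"
proof -
  have "0 < \<tau>" using d4 unfolding tau by (simp add: zero_less_binomial_iff)
  then have "Poly_Mapping.lookup f (Poly_Mapping.single 0 1 + enum 0) = 1" by (auto simp: lookup_f)
  then show ?thesis by auto
qed

lemma AG_Ann_f: "AG (\<tau> + 3) (Ann (\<tau> + 3) f) d"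
  by (rule AG_Ann[OF f_in_Hom f_nonzero])

text \<open>
  A form of degree \<open>i\<close> annihilates \<open>f\<close> as soon as its coefficients at the monomials in \<open>u\<^sub>1, u\<^sub>2, u\<^sub>3\<close>
  vanish and its action on \<open>f\<close> has no term in \<open>u\<^sub>1, u\<^sub>2, u\<^sub>3\<close> alone: \<open>perazzo_hilb d i\<close> linear conditions.
\<close>

lemma hilb_le:
  assumes i: "1 \<le> i" "i < d"
  shows "hilb (\<tau> + 3) (Ann (\<tau> + 3) f) i \<le> perazzo_hilb d i"
proof -
  let ?n = "\<tau> + 3" and ?M = "\<lambda>k. {m. Poly_Mapping.keys m \<subseteq> uvars \<and> mdeg m = k}"
  let ?\<phi> = "\<lambda>k p. case k of Inl \<alpha> \<Rightarrow> Poly_Mapping.lookup p \<alpha>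
      | Inr m \<Rightarrow> pair f (p * Poly_Mapping.single m 1)"
  define K where "K = ?M i <+> ?M (d - i)"
  have fin: "finite (?M k)" for k by (rule finite_monomials) simp
  define V where "V = {p \<in> Hom ?n i. \<forall>k\<in>K. ?\<phi> k p = 0}"
  have "finite K" using fin by (simp only: K_def finite_Plus)
  then have V: "graded_subspace ?n i V \<and> mp.dim (Hom ?n i :: 'a mpoly set) \<le> mp.dim V + card K"
    unfolding V_def
    by (rule dim_le_kernels[OF graded_subspace_Hom])
      (auto simp: lookup_add distrib_right pair_add pair_smult mult_smult_left split: sum.splits)
  have "V \<subseteq> Ann ?n f"
  proof
    fix p assume p: "p \<in> V"
    then have p1: "p \<in> Hom ?n i" and pK: "\<And>k. k \<in> K \<Longrightarrow> ?\<phi> k p = 0"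
      unfolding V_def by blast+
    have p2: "Poly_Mapping.lookup p \<alpha> = 0" if "\<alpha> \<in> ?M i" for \<alpha>
      using pK[OF InlI[OF that, of "?M (d - i)", folded K_def]] by simp
    have p3: "pair f (p * Poly_Mapping.single m 1) = 0" if "m \<in> ?M (d - i)" for m
      using pK[OF InrI[OF that, of "?M i", folded K_def]] by simp
    have "pair f (p * Poly_Mapping.single m 1) = 0" for m
    proof (cases "m \<in> ?M (d - i)")
      case False
      have "Poly_Mapping.lookup f (\<alpha> + m) = 0" if \<alpha>: "\<alpha> \<in> Poly_Mapping.keys p" for \<alpha>
      proof (rule ccontr)
        assume "Poly_Mapping.lookup f (\<alpha> + m) \<noteq> 0"
        then obtain j where j: "j < \<tau>" "\<alpha> + m = Poly_Mapping.single j 1 + enum j"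
          by (auto simp: lookup_f split: if_splits)
        have d\<alpha>: "mdeg \<alpha> = i" using \<alpha> p1 by (auto simp: Hom_def)
        have "mdeg \<alpha> + mdeg m = d"
          using arg_cong[OF j(2), of mdeg] enumD(2)[OF j(1)] d4 by (simp add: mdeg_add)
        then have dm: "mdeg m = d - i" using d\<alpha> by simp
        have keys: "Poly_Mapping.keys \<alpha> \<union> Poly_Mapping.keys m \<subseteq> insert j uvars"
          using arg_cong[OF j(2), of Poly_Mapping.keys] enumD(1)[OF j(1)] by (auto simp: keys_add_nat)
        \<comment> \<open>The variable x_j occurs in this monomial of f to the first power, so it
          divides only one of the two factors. The other factor involves only the u's and is covered
          by one of the two families of conditions.\<close>
        have "Poly_Mapping.lookup \<alpha> j + Poly_Mapping.lookup m j = 1"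
          using arg_cong[OF j(2), of "\<lambda>m. Poly_Mapping.lookup m j"] lookup_enum[OF j(1) j(1)]
          by (simp add: lookup_add)
        then have "j \<notin> Poly_Mapping.keys \<alpha> \<or> j \<notin> Poly_Mapping.keys m"
          by (auto simp: in_keys_iff)
        then show False
        proof
          assume "j \<notin> Poly_Mapping.keys \<alpha>"
          then have "\<alpha> \<in> ?M i" using keys d\<alpha> by auto
          then show False using p2 \<alpha> by (simp add: in_keys_iff)
        next
          assume "j \<notin> Poly_Mapping.keys m"
          then have "m \<in> ?M (d - i)" using keys dm by auto
          then show False using False by blast
        qed
      qed
      then show ?thesis by (simp add: pair_mult_single[of "Poly_Mapping.keys p"])
    qed (rule p3)
    then show "p \<in> Ann ?n f" using p1 by (simp add: Ann_iff_pair Hom_subset_Pol)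
  qed
  then have "V \<subseteq> Ann ?n f \<inter> Hom ?n i" using V by (auto simp: graded_subspace_def)
  then have "mp.dim V \<le> mp.dim (Ann ?n f \<inter> Hom ?n i)"
    using graded_subspace_dim_mono[OF conjunct1[OF V] hom_ideal_soc(1)[OF hom_ideal_Ann[OF f_in_Hom]]] by blast
  moreover have "card K \<le> perazzo_hilb d i"
    unfolding K_def perazzo_hilb_def
    using card_monomials3_le[of \<tau> i] card_monomials3_le[of \<tau> "d - i"] fin by (simp add: card_Plus)
  ultimately show ?thesis using V unfolding hilb_eq_cod cod_def by linarith
qed

text \<open>The coefficient at m singles out one first partial derivative of f, so these derivatives
  are linearly independent and the annihilator contains no linear form. For x_k the witness is
  M_k.\<close>

lemma separating_monomial:
  assumes "k < \<tau> + 3"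
  obtains m where "Poly_Mapping.lookup f (Poly_Mapping.single k 1 + m) \<noteq> 0"
    "\<And>k'. k' < \<tau> + 3 \<Longrightarrow> k' \<noteq> k \<Longrightarrow> Poly_Mapping.lookup f (Poly_Mapping.single k' 1 + m) = 0"
proof (cases "k < \<tau>")
  case True
  show ?thesis
  proof (rule that[of "enum k"])
    show "Poly_Mapping.lookup f (Poly_Mapping.single k 1 + enum k) \<noteq> 0"
      using True by (auto simp: lookup_f)
    fix k' assume k': "k' < \<tau> + 3" "k' \<noteq> k"
    show "Poly_Mapping.lookup f (Poly_Mapping.single k' 1 + enum k) = 0"
    proof (rule ccontr)
      assume "\<not> ?thesis"
      then obtain j where j: "j < \<tau>" "Poly_Mapping.single k' 1 + enum k = Poly_Mapping.single j 1 + enum j"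
        by (auto simp: lookup_f split: if_splits)
      have "k' = j"
        using arg_cong[OF j(2), of "\<lambda>m. Poly_Mapping.lookup m j"] lookup_enum[OF True j(1)]
        by (auto simp: lookup_add lookup_single when_def split: if_splits)
      then have "enum k = enum j" using j(2) by simp
      then have "k = j" using enum True j(1) by (auto simp: bij_betw_def inj_on_def)
      then show False using k' \<open>k' = j\<close> by simp
    qed
  qed
next
  case False
  then have ku: "k \<in> uvars" using assms by auto
  then have "Poly_Mapping.single k (d - 1) \<in> enum ` {..<\<tau>}"
    using enum by (auto simp: bij_betw_def)
  then obtain j where j: "j < \<tau>" "enum j = Poly_Mapping.single k (d - 1)" by auto
  \<comment> \<open>For a u variable the pure power M_j of that variable is lowered by one and
    multiplied by x_j.\<close>
  let ?m = "Poly_Mapping.single j 1 + Poly_Mapping.single k (d - 2)"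
  show ?thesis
  proof (rule that[of ?m])
    have "Poly_Mapping.single k 1 + Poly_Mapping.single k (d - 2) = enum j"
      unfolding j(2) using d4 by (simp flip: single_add add: Suc_diff_Suc numeral_eq_Suc)
    then have "Poly_Mapping.single k 1 + ?m = Poly_Mapping.single j 1 + enum j"
      by (metis add.left_commute)
    then show "Poly_Mapping.lookup f (Poly_Mapping.single k 1 + ?m) \<noteq> 0"
      using j(1) by (auto simp: lookup_f simp del: One_nat_def)
    fix k' assume k': "k' < \<tau> + 3" "k' \<noteq> k"
    show "Poly_Mapping.lookup f (Poly_Mapping.single k' 1 + ?m) = 0"
    proof (rule ccontr)
      assume "\<not> ?thesis"
      then obtain j' where j': "j' < \<tau>" "Poly_Mapping.single k' 1 + ?m = Poly_Mapping.single j' 1 + enum j'"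
        by (auto simp: lookup_f split: if_splits)
      have "j' = j"
        using arg_cong[OF j'(2), of "\<lambda>m. Poly_Mapping.lookup m j"] lookup_enum[OF j'(1) j(1)]
        by (auto simp: lookup_add lookup_single when_def split: if_splits)
      then have "Poly_Mapping.single k' 1 + Poly_Mapping.single k (d - 2) = Poly_Mapping.single k (d - 1)"
        using j'(2) j(2) by (metis add.left_commute add_left_cancel)
      from arg_cong[OF this, of "\<lambda>m. Poly_Mapping.lookup m k'"] k'
      show False by (simp add: lookup_add lookup_single when_def)
    qed
  qed
qed

lemma Ann_f_linear: "Ann (\<tau> + 3) f \<inter> Hom (\<tau> + 3) 1 = {0}"
proof -
  let ?n = "\<tau> + 3"
  have "q = 0" if q: "q \<in> Ann ?n f" "q \<in> Hom ?n 1" for q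
  proof -
    let ?S = "(\<lambda>k. Poly_Mapping.single k 1) ` {..<?n}"
    have keys: "Poly_Mapping.keys q \<subseteq> ?S"
    proof
      fix m assume "m \<in> Poly_Mapping.keys q"
      then have m: "Poly_Mapping.keys m \<subseteq> {..<?n}" "mdeg m = 1" using q(2) by (auto simp: Hom_def Pol_def)
      then have "m \<noteq> 0" by auto
      then obtain k where k: "k \<in> Poly_Mapping.keys m" by (metis all_not_in_conv keys_eq_empty)
      have eq: "m = Poly_Mapping.single k 1 + (m - Poly_Mapping.single k 1)"
        using single_add_diff[OF k] by simp
      have "mdeg m = 1 + mdeg (m - Poly_Mapping.single k 1)"
        by (subst eq) (simp add: mdeg_add)
      then have "m - Poly_Mapping.single k 1 = 0" using m(2) by (simp add: mdeg_eq_0_iff)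
      then have "m = Poly_Mapping.single k 1" using eq by simp
      then show "m \<in> ?S" using m(1) k by blast
    qed
    have "Poly_Mapping.lookup q (Poly_Mapping.single k 1) = 0" if k: "k < ?n" for k
    proof -
      obtain m where m: "Poly_Mapping.lookup f (Poly_Mapping.single k 1 + m) \<noteq> 0"
        "\<And>k'. k' < ?n \<Longrightarrow> k' \<noteq> k \<Longrightarrow> Poly_Mapping.lookup f (Poly_Mapping.single k' 1 + m) = 0"
        using separating_monomial[OF k] by blast
      let ?t = "\<lambda>\<alpha>. Poly_Mapping.lookup q \<alpha> * (Poly_Mapping.lookup f (\<alpha> + m) * mfac (\<alpha> + m))"
      have "0 = (\<Sum>\<alpha>\<in>?S. ?t \<alpha>)"
        using q(1) pair_mult_single[OF _ keys, of f m] by (simp add: Ann_iff_pair)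
      also have "\<dots> = (\<Sum>\<alpha>\<in>{Poly_Mapping.single k 1}. ?t \<alpha>)"
        using m(2) k by (intro sum.mono_neutral_right) auto
      finally show ?thesis using m(1) by simp
    qed
    then have "m \<notin> Poly_Mapping.keys q" for m using keys by (auto simp: in_keys_iff)
    then show "q = 0" by (metis all_not_in_conv keys_eq_empty)
  qed
  then show ?thesis
    using hom_idealD(3)[OF hom_ideal_Ann[OF f_in_Hom]] by (auto dest: mp.subspace_0)
qed

text \<open>At i = 1 the general upper bound is C(3,2) + C(d+1,2). The lower bound comes from the
  independence of the variables and \<open>Ann_f_linear\<close>.\<close>

lemma hilb_1: "hilb (\<tau> + 3) (Ann (\<tau> + 3) f) 1 = 3 + \<tau>"
proof (rule antisym)
  have "d - 1 + 2 = d + 1" using d4 by simp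
  then show "hilb (\<tau> + 3) (Ann (\<tau> + 3) f) 1 \<le> 3 + \<tau>"
    using hilb_le[of 1] d4 by (simp add: perazzo_hilb_def tau numeral_eq_Suc)
  let ?n = "\<tau> + 3" and ?A = "Var ` {..<\<tau> + 3} :: 'a mpoly set"
  have inj: "inj_on (Var :: nat \<Rightarrow> 'a mpoly) {..<?n}"
    by (rule inj_onI) (metis Var_def keys_single singleton_inject zero_neq_one)
  have "mp.independent ?A"
  proof (rule mp.independent_if_scalars_zero)
    fix c and x :: "'a mpoly"
    assume c: "(\<Sum>x\<in>?A. smult (c x) x) = 0" and x: "x \<in> ?A"
    then obtain j where j: "j < ?n" "x = Var j" by auto
    have "0 = Poly_Mapping.lookup (\<Sum>k<?n. smult (c (Var k)) (Var k)) (Poly_Mapping.single j 1)"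
      using c by (simp add: sum.reindex[OF inj])
    also have "\<dots> = (\<Sum>k<?n. if k = j then c (Var j) else 0)"
      unfolding lookup_sum
      by (intro sum.cong) (auto simp: Var_def lookup_single when_def dest: arg_cong[of _ _ Poly_Mapping.keys])
    finally show "c x = 0" using j by simp
  qed simp
  moreover have "?A \<subseteq> Hom ?n 1" using Var_in_Hom by blast
  ultimately obtain B where "?A \<subseteq> B" "finite B" "card B = mp.dim (Hom ?n 1 :: 'a mpoly set)"
    using Hom_finite_span[of ?n 1] mp.finite_basis_extend[OF subspace_Hom] by metis
  then have "card ?A \<le> mp.dim (Hom ?n 1 :: 'a mpoly set)" by (metis card_mono)
  then show "3 + \<tau> \<le> hilb ?n (Ann ?n f) 1"
    using mp.dim_le_card[of "{0 :: 'a mpoly}" "{}"] unfolding hilb_eq_cod Ann_f_linear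
    by (simp add: card_image[OF inj] cod_def)
qed

end

theorem theorem4p2:
  fixes d :: nat and enum :: "nat \<Rightarrow> (nat \<Rightarrow>\<^sub>0 nat)"
    and f :: "'a::field_char_0 mpoly"
  defines "\<tau> \<equiv> (d + 1) choose 2"
  assumes d4: "d \<ge> 4"
    and enum: "bij_betw enum {..<\<tau>}
                 {m. Poly_Mapping.keys m \<subseteq> {\<tau>, \<tau>+1, \<tau>+2} \<and> mdeg m = d - 1}"
    and f_def: "f = (\<Sum>j<\<tau>. Poly_Mapping.single (Poly_Mapping.single j 1 + enum j) 1)"
  shows "AG (\<tau> + 3) (Ann (\<tau> + 3) f) d \<and> hilb (\<tau> + 3) (Ann (\<tau> + 3) f) 1 = 3 + \<tau> \<and>
    (\<forall>n (I :: 'a mpoly set).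
       AG n I d \<and> hilb n I 1 = 3 + \<tau> \<and>
       (\<forall>i. hilb n I i \<le> hilb (\<tau> + 3) (Ann (\<tau> + 3) f) i)
       \<longrightarrow> (\<forall>i. hilb n I i = hilb (\<tau> + 3) (Ann (\<tau> + 3) f) i))"
proof -
  interpret full_perazzo d \<tau> enum f
    by standard (use \<tau>_def d4 enum f_def in auto)
  let ?h = "hilb (\<tau> + 3) (Ann (\<tau> + 3) f)"
  have "hilb n I i = ?h i"
    if I: "AG n I d" and h1: "hilb n I 1 = 3 + \<tau>" and le: "\<And>i. hilb n I i \<le> ?h i"
    for n i and I :: "'a mpoly set"
  proof -
    consider "i = 0" | "i = d" | "i > d" | "1 \<le> i" "i < d" by linarith
    then show ?thesis
    proof cases
      case 4
      \<comment> \<open>The competitor lies below the function of f, which lies below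
        \<open>perazzo_hilb\<close>. Minimality lifts the competitor to the upper end, so all three
        agree.\<close>
      have "hilb n I i = perazzo_hilb d i"
      proof (rule AG_minimal[OF I _ _ _ 4])
        show "hilb n I j \<le> perazzo_hilb d j" if "1 \<le> j" "j < d" for j
          using le[of j] hilb_le[OF that] by linarith
      qed (use d4 h1 \<tau>_def in auto)
      then show ?thesis using le[of i] hilb_le[OF 4] by simp
    qed (simp_all add: AG_hilb_ends[OF I] AG_hilb_ends[OF AG_Ann_f])
  qed
  then show ?thesis using AG_Ann_f hilb_1 by blast
qed

end
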